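(* Let $P_n(x)$ ($n\in\mathbb N_0$) be the monic polynomial system given by the differential equation $\sigma(x)y''(x)+\tau(x)y'(x)+\lambda_ny(x)=0$ with $\sigma(x)=ax^2+bx+c$, $\tau(x)=dx+e$, $\lambda_n=-(an(n-1)+dn)$. Then the coefficients $C_m(n)$ given by $P_n(x)=\sum_{m=0}^nC_m(n)x^m$ satisfy $$(m-n)(an+d-a+am)C_m(n)+(m+1)(bm+e)C_{m+1}(n)+c(m+1)(m+2)C_{m+2}(n)=0 .$$ In particular, if $c=0$, then $$(m-n)(an+d-a+am)C_m(n)+(m+1)(bm+e)C_{m+1}(n)=0,$$ and $$P_n(x)=\frac{\left(\frac eb\right)_n\left(\frac{d-a}{a}\right)_n}{\left(\frac{d-a}{2a}\right)_n\left(\frac{d}{2a}\right)_n}\left(\frac{b}{4a}\right)^n{}_2F_1\left(-n,\tfrac{d+(n-1)a}{a};\tfrac eb;-\tfrac abx\right)\quad(a\ne0),$$ $$P_n(x)=\left(\frac eb\right)_n\left(\frac bd\right)^n{}_1F_1\left(-n;\tfrac eb;-\tfrac dbx\right)\quad(a=0,\ b\ne0),$$ $$P_n(x)=\left(\frac ed\right)^n{}_1F_0\left(-n;-;-\tfrac dex\right)\quad(a=0,\ b=0).$$ Therefore, the classical continuous orthogonal polynomials and their monic counterparts have the following representations: $$P_n^{(\alpha,\beta)}(x)=\binom{n+\alpha}{n}{}_2F_1\left(-n,n+\alpha+\beta+1;\alpha+1;\tfrac{1-x}2\right)$$ $$=\binom{2n+\alpha+\beta}{n}\left(\tfrac{x-1}2\right)^n{}_2F_1\left(-n,-n-\alpha;-2n-\alpha-\beta;\tfrac2{1-x}\right)$$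 $$=(-1)^n\binom{n+\beta}{n}{}_2F_1\left(-n,n+\alpha+\beta+1;\beta+1;\tfrac{1+x}2\right)$$ $$=\binom{2n+\alpha+\beta}{n}\left(\tfrac{x+1}2\right)^n{}_2F_1\left(-n,-n-\beta;-2n-\alpha-\beta;\tfrac2{1+x}\right),$$ $$\widetilde C_n^\alpha(x)=x^n{}_2F_1\left(-\tfrac n2,-\tfrac n2+\tfrac12;-n-\alpha+1;\tfrac1{x^2}\right),\qquad C_n^\alpha(x)=\frac{(\alpha)_n2^nx^n}{n!}{}_2F_1\left(-\tfrac n2,-\tfrac n2+\tfrac12;-n-\alpha+1;\tfrac1{x^2}\right),$$ $$\widetilde L_n^{(\alpha)}(x)=(1+\alpha)_n(-1)^n{}_1F_1(-n;1+\alpha;x)=x^n{}_2F_0\left(-n,-n-\alpha;-;-\tfrac1x\right),$$ $$L_n^{(\alpha)}(x)=\binom{n+\alpha}n{}_1F_1(-n;1+\alpha;x)=\frac{(-x)^n}{n!}{}_2F_0\left(-n,-n-\alpha;-;-\tfrac1x\right),$$ $$\widetilde H_n(x)=x^n{}_2F_0\left(-\tfrac n2,-\tfrac n2+\tfrac12;-;-\tfrac1{x^2}\right),\qquad H_n(x)=2^nx^n{}_2F_0\left(-\tfrac n2,-\tfrac n2+\tfrac12;-;-\tfrac1{x^2}\right),$$ $$\widetilde B_n^{(\alpha)}(x)=\frac{2^n}{(n+\alpha+1)_n}{}_2F_0\left(-n,n+\alpha+1;-;-\tfrac x2\right)=x^n{}_1F_1\left(-n;-2n-\alpha;\tfrac2x\right),$$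 $$B_n^{(\alpha)}(x)={}_2F_0\left(-n,n+\alpha+1;-;-\tfrac x2\right)=\frac{(n+\alpha+1)_n}{2^n}x^n{}_1F_1\left(-n;-2n-\alpha;\tfrac2x\right).$$
   Context: "$P_n$ given by the differential equation" means: for each $n\in\mathbb N_0$, $P_n$ is the unique monic polynomial of degree $n$ solving the equation with $\lambda_n$ (equivalently $d+ka\ne0$ for all integers $k\ge0$). $n,m$ range over $\mathbb N_0$, and $C_m(n)=0$ for $m>n$. $(u)_k=u(u+1)\cdots(u+k-1)$; ${}_pF_q(\text{upper};\text{lower};z)=\sum_k\frac{\prod(\text{upper})_k}{\prod(\text{lower})_k}\frac{z^k}{k!}$ ("$-$" denotes an empty parameter list); all series here terminate. Formulas are asserted for parameter values and arguments $x$ for which all occurring expressions are defined. The classical families are the polynomial solutions of degree $n$ of $\sigma y''+\tau y'+\lambda_ny=0$ with leading coefficient $k_n$: Jacobi $P_n^{(\alpha,\beta)}$: $\sigma=1-x^2$, $\tau=\beta-\alpha-(\alpha+\beta+2)x$, $k_n=2^{-n}\binom{2n+\alpha+\beta}n$; Gegenbauer $C_n^\alpha$: $\sigma=1-x^2$, $\tau=-(2\alpha+1)x$, $k_n=(\alpha)_n2^n/n!$; Laguerre $L_n^{(\alpha)}$: $\sigma=x$, $\tau=\alpha+1-x$, $k_n=(-1)^n/n!$; Hermite $H_n$: $\sigma=1$, $\tau=-2x$, $k_n=2^n$; Bessel $B_n^{(\alpha)}$: $\sigma=x^2$, $\tau=(\alpha+2)x+2$, $k_n=(n+\alpha+1)_n/2^n$.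 A tilde denotes the monic version (divide by $k_n$). *)

theory Defs
  imports "HOL-Analysis.Analysis"
begin

text \<open>
  The type \<^typ>\<open>'a\<close> of scalars, of class \<open>{banach, real_normed_field}\<close>, stands for the real or
  the complex numbers.
\<close>

text \<open>
  Value at \<open>z\<close> of the generalized hypergeometric series with upper parameters \<open>us\<close> and lower
  parameters \<open>ls\<close>. Because of \<open>0 / 0 = 0\<close>, terms beyond the point where an upper parameter makes
  the series terminate vanish, even if a lower Pochhammer symbol is zero there.
\<close>

definition hyper :: "'a::{banach, real_normed_field} list \<Rightarrow> 'a list \<Rightarrow> 'a \<Rightarrow> 'a" where
  "hyper us ls z = eval_fps (fps_hypergeo us ls 1) z"

lemma hyper_altdef:
  "hyper us ls z = (\<Sum>k. (\<Prod>u\<leftarrow>us. pochhammer u k) / (\<Prod>l\<leftarrow>ls. pochhammer l k) * (z ^ k / fact k))"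
proof -
  have "foldl (\<lambda>r y. r * pochhammer y k) v xs = v * (\<Prod>y\<leftarrow>xs. pochhammer y k)"
    for k v and xs :: "'a list"
    by (induction xs arbitrary: v) (simp_all add: mult.assoc)
  then show ?thesis
    by (simp add: hyper_def eval_fps_def)
qed

definition eigenvalue :: "'a::field \<Rightarrow> 'a \<Rightarrow> nat \<Rightarrow> 'a" where
  "eigenvalue a d n = - (a * of_nat n * (of_nat n - 1) + d * of_nat n)"

definition ode_solution ::
    "'a::field \<Rightarrow> 'a \<Rightarrow> 'a \<Rightarrow> 'a \<Rightarrow> 'a \<Rightarrow> 'a \<Rightarrow> nat \<Rightarrow> 'a poly \<Rightarrow> bool" where
  "ode_solution a b c d e k n p \<longleftrightarrow>
     degree p = n \<and> lead_coeff p = k \<and>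
     (\<forall>x. (a * x\<^sup>2 + b * x + c) * poly (pderiv (pderiv p)) x + (d * x + e) * poly (pderiv p) x
          + eigenvalue a d n * poly p x = 0)"

definition monic_system ::
    "'a::field \<Rightarrow> 'a \<Rightarrow> 'a \<Rightarrow> 'a \<Rightarrow> 'a \<Rightarrow> (nat \<Rightarrow> 'a poly) \<Rightarrow> bool" where
  "monic_system a b c d e P \<longleftrightarrow>
     (\<forall>n. ode_solution a b c d e 1 n (P n) \<and> (\<forall>q. ode_solution a b c d e 1 n q \<longrightarrow> q = P n))"

text \<open>
  The numbers \<open>d + (n + m - 1) a\<close> are the quotients
  \<open>(eigenvalue a d m - eigenvalue a d n) / (n - m)\<close>. So this is the part of the condition
  \<open>\<forall>k. d + k a \<noteq> 0\<close> that concerns the single degree \<open>n\<close>, and it is implied by that condition.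
\<close>

definition admissible :: "'a::field \<Rightarrow> 'a \<Rightarrow> nat \<Rightarrow> bool" where
  "admissible a d n \<longleftrightarrow> (\<forall>m<n. d + of_nat (n + m - 1) * a \<noteq> 0)"

text \<open>Meaningful only if \<open>k \<noteq> 0\<close> and \<open>admissible a d n\<close>.\<close>

definition ode_poly ::
    "'a::field \<Rightarrow> 'a \<Rightarrow> 'a \<Rightarrow> 'a \<Rightarrow> 'a \<Rightarrow> 'a \<Rightarrow> nat \<Rightarrow> 'a poly" where
  "ode_poly a b c d e k n = (THE p. ode_solution a b c d e k n p)"

definition monic_version :: "'a::field poly \<Rightarrow> 'a poly" where
  "monic_version p = smult (inverse (lead_coeff p)) p"

definition jacobi :: "'a::field_char_0 \<Rightarrow> 'a \<Rightarrow> nat \<Rightarrow> 'a poly" where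
  "jacobi \<alpha> \<beta> n = ode_poly (-1) 0 1 (- (\<alpha> + \<beta> + 2)) (\<beta> - \<alpha>)
     (((2 * of_nat n + \<alpha> + \<beta>) gchoose n) / 2 ^ n) n"

definition gegenbauer :: "'a::field_char_0 \<Rightarrow> nat \<Rightarrow> 'a poly" where
  "gegenbauer \<alpha> n = ode_poly (-1) 0 1 (- (2 * \<alpha> + 1)) 0 (pochhammer \<alpha> n * 2 ^ n / fact n) n"

definition laguerre :: "'a::field_char_0 \<Rightarrow> nat \<Rightarrow> 'a poly" where
  "laguerre \<alpha> n = ode_poly 0 1 0 (-1) (\<alpha> + 1) ((-1) ^ n / fact n) n"

definition hermite :: "nat \<Rightarrow> 'a::field_char_0 poly" where
  "hermite n = ode_poly 0 0 1 (-2) 0 (2 ^ n) n"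

definition bessel :: "'a::field_char_0 \<Rightarrow> nat \<Rightarrow> 'a poly" where
  "bessel \<alpha> n = ode_poly 1 0 0 (\<alpha> + 2) 2 (pochhammer (of_nat n + \<alpha> + 1) n / 2 ^ n) n"

end

theory Submission
  imports Defs
begin

text \<open>
  Comparing coefficients turns the differential equation into the three-term recurrence for the
  coefficients (\<open>ode_solution_iff_recurrence\<close>). If one of its three terms drops out, the quotient of
  the remaining two coefficients is a rational function of the index, and that is what defines a
  hypergeometric series (\<open>sum_eq_hyper\<close>). This happens in two ways.

  For \<open>c = 0\<close> neighbouring coefficients are related. Read upwards from the constant coefficient, the
  recurrence gives a series in \<open>x\<close>, whose prefactor \<open>p(0)\<close> is found by multiplying the recurrence over
  all degrees below \<open>n\<close> (\<open>ode_solution_coeff_0\<close>). Read downwards from the leading coefficient, it gives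
  \<open>x\<^sup>n\<close> times a series in \<open>1 / x\<close>. The quotient is that of \<open>(m - n) (d + (n + m - 1) a)\<close> and
  \<open>(m + 1) (b m + e)\<close>, up to sign. The factors \<open>d + (n + m - 1) a\<close> and \<open>b m + e\<close> each contribute a
  parameter to the series if their slope \<open>a\<close> or \<open>b\<close> is nonzero, and merely a constant in its
  argument otherwise; this is the source of the different types \<open>2F1\<close>, \<open>1F1\<close>, \<open>2F0\<close> and \<open>1F0\<close>.
  Laguerre and Bessel polynomials have \<open>c = 0\<close> from the start. For Jacobi polynomials one moves the origin to one of the zeros \<open>1\<close> and \<open>-1\<close> of
  \<open>1 - x\<^sup>2\<close> (\<open>ode_solution_shift\<close>), which yields two series for each zero.

  For \<open>b = e = 0\<close> coefficients two degrees apart are related. Those of the wrong parity vanish, and the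
  others give \<open>x\<^sup>n\<close> times a series in \<open>1 / x\<^sup>2\<close>. This covers Gegenbauer and Hermite polynomials.

  Existence and uniqueness come from the same recurrence: the coefficient of degree \<open>m\<close> is multiplied
  by \<open>(m - n) (d + (n + m - 1) a)\<close>, so the coefficients below a given leading one can be solved for, one
  after the other, if these numbers are nonzero for \<open>m < n\<close>. In a monic system they are nonzero, since
  otherwise \<open>P\<^sub>m\<close> and \<open>P\<^sub>n\<close> would belong to the same eigenvalue, and \<open>P\<^sub>n + P\<^sub>m\<close> would be
  a second monic solution of degree \<open>n\<close> (\<open>monic_system_admissible\<close>).
\<close>

section \<open>Terminating hypergeometric sums\<close>

lemma prod_list_pochhammer_Suc:
  fixes us :: "'a::comm_semiring_1 list"
  shows "(\<Prod>u\<leftarrow>us. pochhammer u (Suc k)) = (\<Prod>u\<leftarrow>us. pochhammer u k) * (\<Prod>u\<leftarrow>us. u + of_nat k)"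
  by (induction us) (simp_all add: pochhammer_Suc ac_simps)

text \<open>
  The step hypothesis is the term ratio of the series, multiplied out, so that it also makes sense
  where the terms \<open>s k\<close> vanish. The upper parameter \<open>-N\<close> is what stops the series after \<open>N\<close>.
\<close>
lemma sum_eq_hyper:
  fixes s :: "nat \<Rightarrow> 'a::{banach, real_normed_field}"
  assumes step: "\<And>k. k < N \<Longrightarrow>
      s (Suc k) * (of_nat (Suc k) * (\<Prod>l\<leftarrow>ls. l + of_nat k)) = s k * z * (\<Prod>u\<leftarrow>us. u + of_nat k)"
    and lower: "\<And>k. k < N \<Longrightarrow> (\<Prod>l\<leftarrow>ls. l + of_nat k) \<noteq> 0"
    and upper: "- of_nat N \<in> set us"
  shows "(\<Sum>k\<le>N. s k) = s 0 * hyper us ls z"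
proof -
  define t where
    "t k = (\<Prod>u\<leftarrow>us. pochhammer u k) / (\<Prod>l\<leftarrow>ls. pochhammer l k) * (z ^ k / fact k)" for k
  have "(\<Prod>l\<leftarrow>ls. pochhammer l k) \<noteq> 0 \<and> s k = s 0 * t k" if "k \<le> N" for k
    using that
  proof (induction k)
    case 0
    have "(\<Prod>l\<leftarrow>ls. pochhammer l 0) = 1" for ls :: "'a list"
      by (induction ls) simp_all
    then show ?case by (simp add: t_def)
  next
    case (Suc k)
    let ?L = "\<Prod>l\<leftarrow>ls. l + of_nat k" and ?U = "\<Prod>u\<leftarrow>us. u + of_nat k"
    from Suc have k: "k < N" and L: "(\<Prod>l\<leftarrow>ls. pochhammer l k) \<noteq> 0" and sk: "s k = s 0 * t k"
      by simp_all
    have L0: "?L \<noteq> 0" using lower[OF k] .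
    have n0: "(1 + of_nat k :: 'a) \<noteq> 0"
      by (metis of_nat_Suc of_nat_eq_0_iff nat.distinct(1))
    have "s (Suc k) = s k * z * ?U / (of_nat (Suc k) * ?L)"
      using step[OF k] L0 n0 by (simp add: eq_divide_eq)
    also have "\<dots> = s 0 * t (Suc k)"
      unfolding sk t_def prod_list_pochhammer_Suc using L L0 n0 by (simp add: ac_simps)
    finally show ?case
      using L L0 unfolding prod_list_pochhammer_Suc by simp
  qed
  then have "(\<Sum>k\<le>N. s k) = (\<Sum>k\<le>N. s 0 * t k)"
    by (intro sum.cong[OF refl]) blast
  also have "\<dots> = s 0 * (\<Sum>k\<le>N. t k)"
    by (rule sum_distrib_left[symmetric])
  \<comment> \<open>Beyond \<open>N\<close> a lower Pochhammer symbol may vanish; then the term is \<open>0 / 0 = 0\<close>.\<close>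
  also have "(\<Sum>k\<le>N. t k) = (\<Sum>k. t k)"
  proof (rule suminf_finite[symmetric])
    fix k assume "k \<notin> {..N}"
    then have "N < k" by simp
    have "pochhammer (- of_nat N :: 'a) k = 0"
      by (rule pochhammer_of_nat_eq_0_lemma[OF \<open>N < k\<close>])
    with upper have "0 \<in> set (map (\<lambda>u. pochhammer u k) us)"
      by (metis image_eqI set_map)
    then have "(\<Prod>u\<leftarrow>us. pochhammer u k) = 0"
      by (simp add: prod_list_zero_iff)
    then show "t k = 0" by (simp add: t_def)
  qed simp
  finally show ?thesis by (simp add: hyper_altdef t_def)
qed

lemma poly_eq_ascending_hyper:
  fixes p :: "'a::{banach, real_normed_field} poly"
  assumes deg: "degree p = n"
    and step: "\<And>k. k < n \<Longrightarrow> coeff p (Suc k) * (of_nat (Suc k) * (\<Prod>l\<leftarrow>ls. l + of_nat k))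
                 = coeff p k * w * (\<Prod>u\<leftarrow>us. u + of_nat k)"
    and lower: "\<And>k. k < n \<Longrightarrow> (\<Prod>l\<leftarrow>ls. l + of_nat k) \<noteq> 0"
    and upper: "- of_nat n \<in> set us"
  shows "poly p x = coeff p 0 * hyper us ls (w * x)"
proof -
  have "poly p x = (\<Sum>k\<le>n. coeff p k * x ^ k)"
    using deg by (simp add: poly_altdef)
  also have "\<dots> = coeff p 0 * x ^ 0 * hyper us ls (w * x)"
  proof (rule sum_eq_hyper[OF _ lower upper])
    fix k assume "k < n"
    have "coeff p (Suc k) * x ^ Suc k * (of_nat (Suc k) * (\<Prod>l\<leftarrow>ls. l + of_nat k))
        = coeff p (Suc k) * (of_nat (Suc k) * (\<Prod>l\<leftarrow>ls. l + of_nat k)) * x ^ Suc k"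
      by (simp only: ac_simps)
    also have "\<dots> = coeff p k * w * (\<Prod>u\<leftarrow>us. u + of_nat k) * x ^ Suc k"
      by (simp only: step[OF \<open>k < n\<close>])
    finally show "coeff p (Suc k) * x ^ Suc k * (of_nat (Suc k) * (\<Prod>l\<leftarrow>ls. l + of_nat k))
        = coeff p k * x ^ k * (w * x) * (\<Prod>u\<leftarrow>us. u + of_nat k)"
      by (simp only: power_Suc ac_simps)
  qed
  finally show ?thesis by simp
qed

text \<open>
  The terms are summed from the top: the \<open>k\<close>-th one has degree \<open>n - k\<close>, so each step divides by \<open>x\<close>.
\<close>
lemma poly_eq_descending_hyper:
  fixes p :: "'a::{banach, real_normed_field} poly"
  assumes deg: "degree p = n" and x: "x \<noteq> 0"
    and step: "\<And>k. k < n \<Longrightarrow> coeff p (n - Suc k) * (of_nat (Suc k) * (\<Prod>l\<leftarrow>ls. l + of_nat k))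
                 = coeff p (n - k) * w * (\<Prod>u\<leftarrow>us. u + of_nat k)"
    and lower: "\<And>k. k < n \<Longrightarrow> (\<Prod>l\<leftarrow>ls. l + of_nat k) \<noteq> 0"
    and upper: "- of_nat n \<in> set us"
  shows "poly p x = coeff p n * x ^ n * hyper us ls (w / x)"
proof -
  have "poly p x = (\<Sum>k\<le>n. coeff p k * x ^ k)"
    using deg by (simp add: poly_altdef)
  also have "\<dots> = (\<Sum>k\<le>n. coeff p (n - k) * x ^ (n - k))"
    by (rule sum.reindex_bij_witness[where i = "\<lambda>k. n - k" and j = "\<lambda>k. n - k"]) auto
  also have "\<dots> = coeff p (n - 0) * x ^ (n - 0) * hyper us ls (w / x)"
  proof (rule sum_eq_hyper[OF _ lower upper])
    fix k assume "k < n"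
    then have "x ^ (n - k) = x * x ^ (n - Suc k)"
      by (metis Suc_diff_Suc power_Suc)
    with step[OF \<open>k < n\<close>] x show
      "coeff p (n - Suc k) * x ^ (n - Suc k) * (of_nat (Suc k) * (\<Prod>l\<leftarrow>ls. l + of_nat k))
        = coeff p (n - k) * x ^ (n - k) * (w / x) * (\<Prod>u\<leftarrow>us. u + of_nat k)"
      by (simp del: of_nat_Suc add: ac_simps)
  qed
  finally show ?thesis by simp
qed

text \<open>
  For a polynomial of the parity of its degree the terms from the top fall by two degrees at a time and
  end in degree \<open>0\<close> or \<open>1\<close>, after \<open>n div 2\<close> steps.
\<close>
lemma poly_eq_descending_even_hyper:
  fixes p :: "'a::{banach, real_normed_field} poly"
  assumes deg: "degree p = n" and x: "x \<noteq> 0"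
    and odd: "\<And>m. m \<le> n \<Longrightarrow> odd (n - m) \<Longrightarrow> coeff p m = 0"
    and step: "\<And>k. k < n div 2 \<Longrightarrow>
        coeff p (n - 2 * Suc k) * (of_nat (Suc k) * (\<Prod>l\<leftarrow>ls. l + of_nat k))
        = coeff p (n - 2 * k) * w * (\<Prod>u\<leftarrow>us. u + of_nat k)"
    and lower: "\<And>k. k < n div 2 \<Longrightarrow> (\<Prod>l\<leftarrow>ls. l + of_nat k) \<noteq> 0"
    and upper: "- of_nat (n div 2) \<in> set us"
  shows "poly p x = coeff p n * x ^ n * hyper us ls (w / x\<^sup>2)"
proof -
  have "poly p x = (\<Sum>m\<le>n. coeff p m * x ^ m)"
    using deg by (simp add: poly_altdef)
  also have "\<dots> = (\<Sum>m\<in>(\<lambda>k. n - 2 * k) ` {..n div 2}. coeff p m * x ^ m)"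
  proof (rule sum.mono_neutral_right)
    show "\<forall>i\<in>{..n} - (\<lambda>k. n - 2 * k) ` {..n div 2}. coeff p i * x ^ i = 0"
    proof
      fix i assume i: "i \<in> {..n} - (\<lambda>k. n - 2 * k) ` {..n div 2}"
      have "odd (n - i)"
      proof
        assume "even (n - i)"
        then have "i = n - 2 * ((n - i) div 2)" "(n - i) div 2 \<in> {..n div 2}"
          using i by auto
        with i show False by blast
      qed
      with odd i show "coeff p i * x ^ i = 0" by simp
    qed
  qed auto
  also have "\<dots> = (\<Sum>k\<le>n div 2. coeff p (n - 2 * k) * x ^ (n - 2 * k))"
  proof (rule sum.reindex_cong[OF _ refl refl])
    show "inj_on (\<lambda>k. n - 2 * k) {..n div 2}"
      by (intro inj_onI) auto
  qed
  also have "\<dots> = coeff p (n - 2 * 0) * x ^ (n - 2 * 0) * hyper us ls (w / x\<^sup>2)"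
  proof (rule sum_eq_hyper[OF _ lower upper])
    fix k assume "k < n div 2"
    then have "n - 2 * k = 2 + (n - 2 * Suc k)" by simp
    then have "x ^ (n - 2 * k) = x\<^sup>2 * x ^ (n - 2 * Suc k)"
      by (metis power_add)
    with step[OF \<open>k < n div 2\<close>] x show
      "coeff p (n - 2 * Suc k) * x ^ (n - 2 * Suc k) * (of_nat (Suc k) * (\<Prod>l\<leftarrow>ls. l + of_nat k))
        = coeff p (n - 2 * k) * x ^ (n - 2 * k) * (w / x\<^sup>2) * (\<Prod>u\<leftarrow>us. u + of_nat k)"
      by (simp del: of_nat_Suc mult_Suc_right add: ac_simps)
  qed
  finally show ?thesis by simp
qed

section \<open>The differential equation in terms of coefficients\<close>

text \<open>
  The coefficient of \<open>x\<^sup>m\<close> on the left-hand side of the equation. The factor of \<open>coeff p m\<close> is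
  \<open>a m (m - 1) + d m\<close> minus the same expression for \<open>n\<close>, hence divisible by \<open>m - n\<close>.
\<close>
lemma ode_solution_iff_recurrence:
  fixes p :: "'a::field_char_0 poly"
  shows "ode_solution a b c d e k n p \<longleftrightarrow> degree p = n \<and> lead_coeff p = k \<and>
    (\<forall>m. (of_nat m - of_nat n) * (a * of_nat n + d - a + a * of_nat m) * coeff p m
         + (of_nat m + 1) * (b * of_nat m + e) * coeff p (m + 1)
         + c * (of_nat m + 1) * (of_nat m + 2) * coeff p (m + 2) = 0)"
proof -
  define q where "q = [:c, b, a:] * pderiv (pderiv p) + [:e, d:] * pderiv p + smult (eigenvalue a d n) p"
  have "coeff q m = (of_nat m - of_nat n) * (a * of_nat n + d - a + a * of_nat m) * coeff p m
         + (of_nat m + 1) * (b * of_nat m + e) * coeff p (m + 1)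
         + c * (of_nat m + 1) * (of_nat m + 2) * coeff p (m + 2)" for m
  proof -
    consider "m = 0" | "m = 1" | j where "m = Suc (Suc j)"
      by (metis One_nat_def not0_implies_Suc)
    then show ?thesis
      by cases (simp_all add: q_def coeff_pderiv eigenvalue_def numeral_2_eq_2 algebra_simps)
  qed
  moreover have "poly q x = (a * x\<^sup>2 + b * x + c) * poly (pderiv (pderiv p)) x
      + (d * x + e) * poly (pderiv p) x + eigenvalue a d n * poly p x" for x
    by (simp add: q_def power2_eq_square algebra_simps)
  moreover have "(\<forall>x. poly q x = 0) \<longleftrightarrow> (\<forall>m. coeff q m = 0)"
    by (simp add: poly_all_0_iff_0 poly_eq_iff)
  ultimately show ?thesis
    unfolding ode_solution_def by simp
qed

lemma ode_solution_recurrence: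
  fixes p :: "'a::field_char_0 poly"
  assumes "ode_solution a b c d e k n p"
  shows "(of_nat m - of_nat n) * (a * of_nat n + d - a + a * of_nat m) * coeff p m
         + (of_nat m + 1) * (b * of_nat m + e) * coeff p (m + 1)
         + c * (of_nat m + 1) * (of_nat m + 2) * coeff p (m + 2) = 0"
  using assms by (simp add: ode_solution_iff_recurrence)

lemma ode_solution_degree:
  assumes "ode_solution a b c d e k n p"
  shows "degree p = n" "coeff p n = k"
  using assms by (auto simp: ode_solution_def)

text \<open>
  The new coefficients are those of \<open>\<sigma>(x + r)\<close> and \<open>\<tau>(x + r)\<close>. If \<open>r\<close> is a zero of \<open>\<sigma>\<close>, the new
  constant term of \<open>\<sigma>\<close> is zero, which reduces the recurrence to two terms.
\<close>
lemma ode_solution_shift: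
  fixes p :: "'a::field_char_0 poly"
  assumes "ode_solution a b c d e k n p"
  shows "ode_solution a (2 * a * r + b) (a * r\<^sup>2 + b * r + c) d (d * r + e) k n (pcompose p [:r, 1:])"
proof -
  have D: "pderiv (pcompose q [:r, 1:]) = pcompose (pderiv q) [:r, 1:]" for q :: "'a poly"
    by (simp add: pderiv_pcompose pderiv_pCons)
  have "(a * x\<^sup>2 + (2 * a * r + b) * x + (a * r\<^sup>2 + b * r + c)) * poly (pderiv (pderiv p)) (x + r)
        + (d * x + (d * r + e)) * poly (pderiv p) (x + r) + eigenvalue a d n * poly p (x + r) = 0" for x
  proof -
    have "a * x\<^sup>2 + (2 * a * r + b) * x + (a * r\<^sup>2 + b * r + c) = a * (x + r)\<^sup>2 + b * (x + r) + c"
      and "d * x + (d * r + e) = d * (x + r) + e"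
      by (simp_all add: power2_eq_square algebra_simps)
    with assms show ?thesis unfolding ode_solution_def by metis
  qed
  moreover have "lead_coeff (pcompose p [:r, 1:]) = lead_coeff p"
    by (subst lead_coeff_comp) simp_all
  moreover have "degree (pcompose p [:r, 1:]) = degree p"
    by (simp add: degree_pcompose)
  ultimately show ?thesis
    using ode_solution_degree[OF assms] by (simp add: ode_solution_def D poly_pcompose ac_simps)
qed

text \<open>
  The recurrence in degree \<open>m = n - 1 - j\<close>, with \<open>m\<close> eliminated in favour of the distance from the top.
\<close>
lemma ode_solution_descent:
  fixes p :: "'a::field_char_0 poly"
  assumes "ode_solution a b 0 d e k n p" and "j < n"
  shows "coeff p (n - Suc j) * (of_nat (Suc j) * (d + (2 * of_nat n - 2 - of_nat j) * a))
       = coeff p (n - j) * ((of_nat n - of_nat j) * (e + (of_nat n - 1 - of_nat j) * b))"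
proof -
  have m: "(of_nat (n - Suc j) :: 'a) = of_nat n - of_nat j - 1"
    using \<open>j < n\<close> by (simp add: of_nat_diff)
  have "n - Suc j + 1 = n - j" using \<open>j < n\<close> by simp
  with ode_solution_recurrence[OF assms(1), of "n - Suc j"] show ?thesis
    unfolding m by (simp add: algebra_simps)
qed

text \<open>
  The product of the recurrences of all degrees \<open>m < n\<close>. The factors \<open>n - m\<close> on one side and \<open>m + 1\<close> on
  the other both multiply to \<open>n!\<close> and cancel. The induction is over the partial products, where they
  do not cancel yet.
\<close>
lemma ode_solution_coeff_0:
  fixes p :: "'a::field_char_0 poly"
  assumes "ode_solution a b 0 d e k n p"
  shows "coeff p 0 * (\<Prod>m<n. d + (of_nat n + of_nat m - 1) * a) = k * (\<Prod>m<n. b * of_nat m + e)"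
proof -
  have "coeff p 0 * (\<Prod>i<m. d + (of_nat n + of_nat i - 1) * a) * (\<Prod>i<m. of_nat n - of_nat i)
      = coeff p m * (\<Prod>i<m. b * of_nat i + e) * fact m" for m
  proof (induction m)
    case (Suc m)
    have "coeff p 0 * (\<Prod>i<Suc m. d + (of_nat n + of_nat i - 1) * a) * (\<Prod>i<Suc m. of_nat n - of_nat i)
        = (coeff p 0 * (\<Prod>i<m. d + (of_nat n + of_nat i - 1) * a) * (\<Prod>i<m. of_nat n - of_nat i))
          * ((d + (of_nat n + of_nat m - 1) * a) * (of_nat n - of_nat m))"
      by simp
    also have "\<dots> = (coeff p m * ((d + (of_nat n + of_nat m - 1) * a) * (of_nat n - of_nat m)))
        * (\<Prod>i<m. b * of_nat i + e) * fact m"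
      unfolding Suc.IH by (simp only: ac_simps)
    also have "coeff p m * ((d + (of_nat n + of_nat m - 1) * a) * (of_nat n - of_nat m))
        = coeff p (Suc m) * ((b * of_nat m + e) * of_nat (Suc m))"
      using ode_solution_recurrence[OF assms, of m] by (simp add: algebra_simps)
    finally show ?case by (simp add: ac_simps)
  qed simp
  from this[of n] have "coeff p 0 * (\<Prod>i<n. d + (of_nat n + of_nat i - 1) * a) * (\<Prod>i<n. of_nat n - of_nat i)
      = k * (\<Prod>i<n. b * of_nat i + e) * fact n"
    using ode_solution_degree[OF assms] by simp
  moreover have "(\<Prod>i<n. of_nat n - of_nat i :: 'a) = fact n"
  proof -
    have "(\<Prod>i<n. of_nat n - of_nat i :: 'a) = (\<Prod>i=0..<n. of_nat (n - i))"
      by (rule prod.cong) (auto simp: of_nat_diff)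
    then show ?thesis by (simp add: fact_prod_rev)
  qed
  ultimately show ?thesis by simp
qed

section \<open>Existence and uniqueness\<close>

lemma admissible_factor:
  fixes a :: "'a::field_char_0"
  assumes "admissible a d n" "m < n"
  shows "d + (of_nat n + of_nat m - 1) * a \<noteq> 0"
proof -
  have "(of_nat (n + m - 1) :: 'a) = of_nat n + of_nat m - 1"
    using \<open>m < n\<close> by (simp add: of_nat_diff)
  with assms show ?thesis unfolding admissible_def by metis
qed

lemma admissible_recurrence_factor:
  fixes a :: "'a::field_char_0"
  assumes "admissible a d n" "m < n"
  shows "(of_nat m - of_nat n) * (a * of_nat n + d - a + a * of_nat m) \<noteq> 0"
proof -
  have "a * of_nat n + d - a + a * of_nat m = d + (of_nat n + of_nat m - 1) * a"
    by (simp add: algebra_simps)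
  with admissible_factor[OF assms] \<open>m < n\<close> show ?thesis
    by (metis mult_eq_0_iff of_nat_eq_iff order_less_irrefl right_minus_eq)
qed

lemma admissible_0:
  fixes d :: "'a::field_char_0"
  assumes "d \<noteq> 0"
  shows "admissible 0 d n"
  using assms by (simp add: admissible_def)

text \<open>
  Going down from the common leading coefficient, the recurrence determines every further one, as its
  factor is nonzero.
\<close>
lemma ode_solution_unique:
  fixes p q :: "'a::field_char_0 poly"
  assumes adm: "admissible a d n"
    and p: "ode_solution a b c d e k n p" and q: "ode_solution a b c d e k n q"
  shows "p = q"
proof -
  have "\<forall>m\<ge>n - j. coeff p m = coeff q m" for j
  proof (induction j)
    case 0
    have "coeff p m = coeff q m" if "m \<ge> n" for m
      using that ode_solution_degree[OF p] ode_solution_degree[OF q]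
      by (cases "m = n") (simp_all add: coeff_eq_0)
    then show ?case by simp
  next
    case (Suc j)
    show ?case
    proof (cases "j < n")
      case True
      define m where "m = n - Suc j"
      have "m < n" and m: "n - j = Suc m" using True by (simp_all add: m_def)
      from Suc.IH m have "coeff p (m + 1) = coeff q (m + 1)" "coeff p (m + 2) = coeff q (m + 2)"
        by simp_all
      with ode_solution_recurrence[OF p, of m] ode_solution_recurrence[OF q, of m]
      have "(of_nat m - of_nat n) * (a * of_nat n + d - a + a * of_nat m) * coeff p m
          = (of_nat m - of_nat n) * (a * of_nat n + d - a + a * of_nat m) * coeff q m"
        by (metis (no_types, lifting) add_right_cancel)
      then have "coeff p m = coeff q m"
        using admissible_recurrence_factor[OF adm \<open>m < n\<close>] by (metis mult_left_cancel)
      with Suc.IH show ?thesis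
        unfolding m m_def[symmetric] by (metis le_antisym not_less_eq_eq)
    next
      case False
      with Suc.IH show ?thesis by simp
    qed
  qed
  from this[of n] show ?thesis by (simp add: poly_eq_iff)
qed

text \<open>
  The recurrence holds automatically in the degrees \<open>m \<ge> n\<close> for any sequence that vanishes above \<open>n\<close>.
  Below, it is enforced one degree at a time: changing the value at \<open>i\<close> affects only the recurrences in
  degrees at most \<open>i\<close>.
\<close>
lemma ode_solution_exists:
  fixes a :: "'a::field_char_0"
  assumes adm: "admissible a d n" and "k \<noteq> 0"
  shows "\<exists>p. ode_solution a b c d e k n p"
proof -
  let ?rec = "\<lambda>f m. (of_nat m - of_nat n) * (a * of_nat n + d - a + a * of_nat m) * f m
      + (of_nat m + 1) * (b * of_nat m + e) * f (m + 1)
      + c * (of_nat m + 1) * (of_nat m + 2) * f (m + 2) = (0::'a)"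
  have "\<exists>f. f n = k \<and> (\<forall>m>n. f m = 0) \<and> (\<forall>m\<ge>n - j. ?rec f m)" if "j \<le> n" for j
    using that
  proof (induction j)
    case 0
    show ?case by (rule exI[of _ "\<lambda>m. if m = n then k else 0"]) simp
  next
    case (Suc j)
    then obtain f where f: "f n = k" "\<forall>m>n. f m = 0" "\<forall>m\<ge>n - j. ?rec f m" by auto
    define i where "i = n - Suc j"
    have "i < n" and i: "n - j = Suc i" using Suc.prems by (simp_all add: i_def)
    define D where "D = (of_nat i - of_nat n) * (a * of_nat n + d - a + a * of_nat i)"
    have D: "D \<noteq> 0"
      unfolding D_def by (rule admissible_recurrence_factor[OF adm \<open>i < n\<close>])
    define v where "v = - ((of_nat i + 1) * (b * of_nat i + e) * f (i + 1)
      + c * (of_nat i + 1) * (of_nat i + 2) * f (i + 2)) / D"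
    have "D * v + (of_nat i + 1) * (b * of_nat i + e) * f (i + 1)
        + c * (of_nat i + 1) * (of_nat i + 2) * f (i + 2) = 0"
      using D by (simp add: v_def)
    then have "?rec (f(i := v)) i"
      unfolding D_def by simp
    moreover have "?rec (f(i := v)) m" if "m > i" for m
      using f(3) that unfolding i by simp
    ultimately have "\<forall>m\<ge>i. ?rec (f(i := v)) m"
      by (metis le_neq_implies_less)
    with f \<open>i < n\<close> show ?case
      unfolding i_def[symmetric] by (intro exI[of _ "f(i := v)"]) simp
  qed
  from this[of n] obtain f where f: "f n = k" "\<forall>m>n. f m = 0" "\<forall>m. ?rec f m" by auto
  define p where "p = (\<Sum>m\<le>n. monom (f m) m)"
  have coeff: "coeff p m = f m" for m
    using f(2) by (cases "m \<le> n") (simp_all add: p_def coeff_sum)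
  have "degree p = n"
  proof (rule antisym)
    show "degree p \<le> n" using f(2) by (intro degree_le) (simp add: coeff)
    show "n \<le> degree p" using f(1) \<open>k \<noteq> 0\<close> by (intro le_degree) (simp add: coeff)
  qed
  then have "ode_solution a b c d e k n p"
    unfolding ode_solution_iff_recurrence coeff using f by simp
  then show ?thesis ..
qed

lemma ode_solution_ode_poly:
  fixes a :: "'a::field_char_0"
  assumes "admissible a d n" "k \<noteq> 0"
  shows "ode_solution a b c d e k n (ode_poly a b c d e k n)"
proof -
  have "\<exists>!p. ode_solution a b c d e k n p"
    using ode_solution_exists[OF assms] ode_solution_unique[OF assms(1)] by blast
  then show ?thesis unfolding ode_poly_def by (rule theI')
qed

text \<open>
  The uniqueness part of the definition is what forces this: if the number vanished, degrees \<open>m\<close> and \<open>n\<close>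
  would have the same eigenvalue, and the lower solution could be added to the higher one.
\<close>
lemma monic_system_admissible:
  fixes a :: "'a::field_char_0"
  assumes "monic_system a b c d e P"
  shows "admissible a d n"
  unfolding admissible_def
proof (intro allI impI notI)
  fix m assume m: "m < n" and zero: "d + of_nat (n + m - 1) * a = 0"
  have Pn: "ode_solution a b c d e 1 n (P n)" and Pm: "ode_solution a b c d e 1 m (P m)"
    and uniq: "\<And>q. ode_solution a b c d e 1 n q \<Longrightarrow> q = P n"
    using assms by (simp_all add: monic_system_def)
  have "(of_nat (n + m - 1) :: 'a) = of_nat n + of_nat m - 1"
    using m by (simp add: of_nat_diff)
  with zero have z: "d + (of_nat n + of_nat m - 1) * a = 0" by simp
  have "eigenvalue a d m - eigenvalue a d n
      = (of_nat n - of_nat m) * (d + (of_nat n + of_nat m - 1) * a)"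
    by (simp add: eigenvalue_def algebra_simps)
  with z have eig: "eigenvalue a d m = eigenvalue a d n" by simp
  have deg: "degree (P m) < degree (P n)"
    using m ode_solution_degree[OF Pn] ode_solution_degree[OF Pm] by simp
  have "coeff (P m) n = 0"
    using deg ode_solution_degree[OF Pn] by (simp add: coeff_eq_0)
  moreover have "degree (P n + P m) = n"
    using degree_add_eq_left[OF deg] ode_solution_degree[OF Pn] by simp
  moreover have "(a * x\<^sup>2 + b * x + c) * poly (pderiv (pderiv (P n + P m))) x
      + (d * x + e) * poly (pderiv (P n + P m)) x + eigenvalue a d n * poly (P n + P m) x = 0" for x
  proof -
    define L where "L q = (a * x\<^sup>2 + b * x + c) * poly (pderiv (pderiv q)) x
      + (d * x + e) * poly (pderiv q) x + eigenvalue a d n * poly q x" for q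
    have "L (P n + P m) = L (P n) + L (P m)"
      by (simp add: L_def pderiv_add algebra_simps)
    moreover have "L (P n) = 0" "L (P m) = 0"
      using Pn Pm eig unfolding L_def ode_solution_def by simp_all
    ultimately show ?thesis by (simp add: L_def)
  qed
  ultimately have "ode_solution a b c d e 1 n (P n + P m)"
    using ode_solution_degree[OF Pn] by (simp add: ode_solution_def)
  from uniq[OF this] have "P m = 0" by simp
  with Pm show False by (simp add: ode_solution_def)
qed

section \<open>Hypergeometric form of the solutions\<close>

lemma prod_linear_eq_pochhammer:
  fixes b :: "'a::field_char_0"
  assumes "b \<noteq> 0"
  shows "(\<Prod>m<n. b * of_nat m + e) = b ^ n * pochhammer (e / b) n"
proof -
  have "(\<Prod>m<n. b * of_nat m + e) = (\<Prod>m<n. b * (e / b + of_nat m))"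
    using assms by (intro prod.cong) (simp_all add: field_simps)
  then show ?thesis
    by (simp add: prod.distrib pochhammer_prod atLeast0LessThan)
qed

lemma pochhammer_factor_nonzero:
  fixes l :: "'a::field_char_0"
  assumes "pochhammer l n \<noteq> 0" "k < n"
  shows "l + of_nat k \<noteq> 0"
proof
  assume "l + of_nat k = 0"
  then have "l = - of_nat k" by (simp add: eq_neg_iff_add_eq_0)
  with assms show False by (auto simp: pochhammer_eq_0_iff)
qed

text \<open>
  The base is \<open>d / a + n - 1\<close>. For Jacobi and Bessel polynomials this Pochhammer symbol is the leading
  coefficient up to powers of 2 and a factorial.
\<close>
lemma prod_admissible_factors:
  fixes a :: "'a::field_char_0"
  assumes "a \<noteq> 0"
  shows "(\<Prod>m<n. d + (of_nat n + of_nat m - 1) * a) = a ^ n * pochhammer ((d + (of_nat n - 1) * a) / a) n"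
proof -
  have "(\<Prod>m<n. d + (of_nat n + of_nat m - 1) * a) = (\<Prod>m<n. a * of_nat m + (d + (of_nat n - 1) * a))"
    by (intro prod.cong) (simp_all add: algebra_simps)
  with prod_linear_eq_pochhammer[OF assms] show ?thesis by simp
qed

lemma admissible_pochhammer:
  fixes a :: "'a::field_char_0"
  assumes "admissible a d n" "a \<noteq> 0"
  shows "pochhammer ((d + (of_nat n - 1) * a) / a) n \<noteq> 0"
proof -
  have "(\<Prod>m<n. d + (of_nat n + of_nat m - 1) * a) \<noteq> 0"
    using admissible_factor[OF assms(1)] by simp
  with prod_admissible_factors[OF assms(2)] show ?thesis by auto
qed

lemma ascending_factor:
  fixes a :: "'a::field_char_0"
  assumes "a \<noteq> 0"
  shows "(m - n) * (a * n + d - a + a * m) = a * ((- n + m) * ((d + (n - 1) * a) / a + m))"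
  using assms by (simp add: field_simps)

lemma descending_factor:
  fixes a :: "'a::field_char_0"
  assumes "a \<noteq> 0"
  shows "d + (2 * n - 2 - m) * a = - a * (2 - 2 * n - d / a + m)"
  using assms by (simp add: field_simps)

lemma descending_lower_nonzero:
  fixes a :: "'a::field_char_0"
  assumes "admissible a d n" "a \<noteq> 0" "j < n"
  shows "2 - 2 * of_nat n - d / a + of_nat j \<noteq> 0"
proof -
  have "(of_nat (n - Suc j) :: 'a) = of_nat n - of_nat j - 1"
    using \<open>j < n\<close> by (simp add: of_nat_diff)
  with admissible_factor[OF assms(1), of "n - Suc j"] \<open>j < n\<close>
  have "d + (2 * of_nat n - 2 - of_nat j) * a \<noteq> 0" by (simp add: algebra_simps)
  then show ?thesis unfolding descending_factor[OF assms(2)] by simp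
qed

text \<open>
  The solutions with \<open>c = 0\<close>. In the names, an ascending form is a series in \<open>x\<close>, obtained from the
  constant coefficient upwards, and a descending form is a series in \<open>1 / x\<close>, obtained from the leading
  coefficient downwards. The fact \<open>cancel\<close> in the proofs below divides the recurrence by the slopes
  (or, where these are zero, the constants) of its linear factors; their quotient enters the argument of
  the series.
\<close>
context
  fixes a b d e k :: "'a::{banach, real_normed_field}" and n :: nat and p :: "'a poly"
  assumes sol: "ode_solution a b 0 d e k n p"
begin

lemma ode_solution_eq_ascending_2F1:
  assumes adm: "admissible a d n" and a: "a \<noteq> 0" and b: "b \<noteq> 0" and lower: "pochhammer (e / b) n \<noteq> 0"
  shows "poly p x = k * (b / a) ^ n * pochhammer (e / b) n / pochhammer ((d + (of_nat n - 1) * a) / a) n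
    * hyper [- of_nat n, (d + (of_nat n - 1) * a) / a] [e / b] (- (a / b) * x)"
proof -
  let ?u = "(d + (of_nat n - 1) * a) / a"
  have "poly p x = coeff p 0 * hyper [- of_nat n, ?u] [e / b] (- (a / b) * x)"
  proof (rule poly_eq_ascending_hyper[OF ode_solution_degree(1)[OF sol]])
    fix m assume "m < n"
    have "(of_nat m + 1) * (b * of_nat m + e) = b * (of_nat (Suc m) * (e / b + of_nat m))"
      using b by (simp add: field_simps)
    with ode_solution_recurrence[OF sol, of m]
    have step:
      "a * ((- of_nat n + of_nat m) * (?u + of_nat m)) * coeff p m
        + b * (of_nat (Suc m) * (e / b + of_nat m)) * coeff p (Suc m) = 0"
      unfolding ascending_factor[OF a] by simp
    have cancel: "C' * Y = C * - (a / b) * X" if "a * X * C + b * Y * C' = 0" for C C' X Y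
      using that b by (simp add: field_simps eq_neg_iff_add_eq_0)
    from cancel[OF step] show "coeff p (Suc m) * (of_nat (Suc m) * (\<Prod>l\<leftarrow>[e / b]. l + of_nat m))
        = coeff p m * - (a / b) * (\<Prod>u\<leftarrow>[- of_nat n, ?u]. u + of_nat m)"
      by simp
  qed (use pochhammer_factor_nonzero[OF lower] in simp_all)
  moreover have "coeff p 0 * (a ^ n * pochhammer ?u n) = k * (b ^ n * pochhammer (e / b) n)"
    using ode_solution_coeff_0[OF sol]
    unfolding prod_admissible_factors[OF a] prod_linear_eq_pochhammer[OF b] .
  then have "coeff p 0 = k * (b / a) ^ n * pochhammer (e / b) n / pochhammer ?u n"
    using a admissible_pochhammer[OF adm a] by (simp add: field_simps)
  ultimately show ?thesis by simp
qed

lemma ode_solution_eq_descending_2F1: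
  assumes adm: "admissible a d n" and a: "a \<noteq> 0" and b: "b \<noteq> 0" and x: "x \<noteq> 0"
  shows "poly p x = k * x ^ n
    * hyper [- of_nat n, 1 - of_nat n - e / b] [2 - 2 * of_nat n - d / a] (- (b / a) / x)"
proof -
  have "poly p x = coeff p n * x ^ n
    * hyper [- of_nat n, 1 - of_nat n - e / b] [2 - 2 * of_nat n - d / a] (- (b / a) / x)"
  proof (rule poly_eq_descending_hyper[OF ode_solution_degree(1)[OF sol] x])
    fix j assume "j < n"
    have "(of_nat n - of_nat j) * (e + (of_nat n - 1 - of_nat j) * b)
        = b * ((- of_nat n + of_nat j) * (1 - of_nat n - e / b + of_nat j))"
      using b by (simp add: field_simps)
    with ode_solution_descent[OF sol \<open>j < n\<close>]
    have step:
      "coeff p (n - Suc j) * (of_nat (Suc j) * (- a * (2 - 2 * of_nat n - d / a + of_nat j)))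
        = coeff p (n - j) * (b * ((- of_nat n + of_nat j) * (1 - of_nat n - e / b + of_nat j)))"
      unfolding descending_factor[OF a] by simp
    have cancel: "C' * (S * Y) = C * - (b / a) * X" if "C' * (S * (- a * Y)) = C * (b * X)" for C C' S X Y
      using that a by (simp add: field_simps minus_equation_iff)
    from cancel[OF step] show "coeff p (n - Suc j) * (of_nat (Suc j) * (\<Prod>l\<leftarrow>[2 - 2 * of_nat n - d / a]. l + of_nat j))
      = coeff p (n - j) * - (b / a) * (\<Prod>u\<leftarrow>[- of_nat n, 1 - of_nat n - e / b]. u + of_nat j)"
      by simp
  qed (use descending_lower_nonzero[OF adm a] in simp_all)
  then show ?thesis using ode_solution_degree[OF sol] by simp
qed

lemma ode_solution_eq_ascending_1F1:
  assumes a: "a = 0" and b: "b \<noteq> 0" and d: "d \<noteq> 0" and lower: "pochhammer (e / b) n \<noteq> 0"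
  shows "poly p x = k * (pochhammer (e / b) n * (b / d) ^ n) * hyper [- of_nat n] [e / b] (- (d / b) * x)"
proof -
  have "poly p x = coeff p 0 * hyper [- of_nat n] [e / b] (- (d / b) * x)"
  proof (rule poly_eq_ascending_hyper[OF ode_solution_degree(1)[OF sol]])
    fix m assume "m < n"
    have "(of_nat m + 1) * (b * of_nat m + e) = b * (of_nat (Suc m) * (e / b + of_nat m))"
      using b by (simp add: field_simps)
    with ode_solution_recurrence[OF sol, of m] a
    have step:
      "d * (- of_nat n + of_nat m) * coeff p m
        + b * (of_nat (Suc m) * (e / b + of_nat m)) * coeff p (Suc m) = 0"
      by (simp add: mult.commute)
    have cancel: "C' * Y = C * - (d / b) * X" if "d * X * C + b * Y * C' = 0" for C C' X Y
      using that b by (simp add: field_simps eq_neg_iff_add_eq_0)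
    from cancel[OF step] show "coeff p (Suc m) * (of_nat (Suc m) * (\<Prod>l\<leftarrow>[e / b]. l + of_nat m))
        = coeff p m * - (d / b) * (\<Prod>u\<leftarrow>[- of_nat n]. u + of_nat m)"
      by simp
  qed (use pochhammer_factor_nonzero[OF lower] in simp_all)
  moreover have "coeff p 0 * d ^ n = k * (b ^ n * pochhammer (e / b) n)"
    using ode_solution_coeff_0[OF sol] a unfolding prod_linear_eq_pochhammer[OF b] by simp
  then have "coeff p 0 = k * (pochhammer (e / b) n * (b / d) ^ n)"
    using d by (simp add: field_simps)
  ultimately show ?thesis by simp
qed

lemma ode_solution_eq_descending_2F0:
  assumes a: "a = 0" and b: "b \<noteq> 0" and d: "d \<noteq> 0" and x: "x \<noteq> 0"
  shows "poly p x = k * x ^ n * hyper [- of_nat n, 1 - of_nat n - e / b] [] (b / d / x)"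
proof -
  have "poly p x = coeff p n * x ^ n * hyper [- of_nat n, 1 - of_nat n - e / b] [] (b / d / x)"
  proof (rule poly_eq_descending_hyper[OF ode_solution_degree(1)[OF sol] x])
    fix j assume "j < n"
    have "(of_nat n - of_nat j) * (e + (of_nat n - 1 - of_nat j) * b)
        = b * ((- of_nat n + of_nat j) * (1 - of_nat n - e / b + of_nat j))"
      using b by (simp add: field_simps)
    with ode_solution_descent[OF sol \<open>j < n\<close>] a
    have step:
      "coeff p (n - Suc j) * (of_nat (Suc j) * d)
        = coeff p (n - j) * (b * ((- of_nat n + of_nat j) * (1 - of_nat n - e / b + of_nat j)))"
      by simp
    have cancel: "C' * S = C * (b / d) * X" if "C' * (S * d) = C * (b * X)" for C C' S X
      using that d by (simp add: field_simps)
    from cancel[OF step] show "coeff p (n - Suc j) * (of_nat (Suc j) * (\<Prod>l\<leftarrow>[]. l + of_nat j))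
      = coeff p (n - j) * (b / d) * (\<Prod>u\<leftarrow>[- of_nat n, 1 - of_nat n - e / b]. u + of_nat j)"
      by simp
  qed simp_all
  then show ?thesis using ode_solution_degree[OF sol] by simp
qed

lemma ode_solution_eq_ascending_1F0:
  assumes a: "a = 0" and b: "b = 0" and d: "d \<noteq> 0" and e: "e \<noteq> 0"
  shows "poly p x = k * (e / d) ^ n * hyper [- of_nat n] [] (- (d / e) * x)"
proof -
  have "poly p x = coeff p 0 * hyper [- of_nat n] [] (- (d / e) * x)"
  proof (rule poly_eq_ascending_hyper[OF ode_solution_degree(1)[OF sol]])
    fix m assume "m < n"
    from ode_solution_recurrence[OF sol, of m] a b
    have step:
      "d * (- of_nat n + of_nat m) * coeff p m + e * of_nat (Suc m) * coeff p (Suc m) = 0"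
      by (simp add: algebra_simps)
    have cancel: "C' * Y = C * - (d / e) * X" if "d * X * C + e * Y * C' = 0" for C C' X Y
      using that e by (simp add: field_simps eq_neg_iff_add_eq_0)
    from cancel[OF step] show "coeff p (Suc m) * (of_nat (Suc m) * (\<Prod>l\<leftarrow>[]. l + of_nat m))
        = coeff p m * - (d / e) * (\<Prod>u\<leftarrow>[- of_nat n]. u + of_nat m)"
      by simp
  qed simp_all
  moreover have "coeff p 0 * d ^ n = k * e ^ n"
    using ode_solution_coeff_0[OF sol] a b by simp
  then have "coeff p 0 = k * (e / d) ^ n"
    using d by (simp add: field_simps)
  ultimately show ?thesis by simp
qed

lemma ode_solution_eq_ascending_2F0:
  assumes adm: "admissible a d n" and a: "a \<noteq> 0" and b: "b = 0" and e: "e \<noteq> 0"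
  shows "poly p x = k * (e / a) ^ n / pochhammer ((d + (of_nat n - 1) * a) / a) n
    * hyper [- of_nat n, (d + (of_nat n - 1) * a) / a] [] (- (a / e) * x)"
proof -
  let ?u = "(d + (of_nat n - 1) * a) / a"
  have "poly p x = coeff p 0 * hyper [- of_nat n, ?u] [] (- (a / e) * x)"
  proof (rule poly_eq_ascending_hyper[OF ode_solution_degree(1)[OF sol]])
    fix m assume "m < n"
    from ode_solution_recurrence[OF sol, of m] b
    have step:
      "a * ((- of_nat n + of_nat m) * (?u + of_nat m)) * coeff p m
        + e * of_nat (Suc m) * coeff p (Suc m) = 0"
      unfolding ascending_factor[OF a] by (simp add: ac_simps)
    have cancel: "C' * Y = C * - (a / e) * X" if "a * X * C + e * Y * C' = 0" for C C' X Y
      using that e by (simp add: field_simps eq_neg_iff_add_eq_0)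
    from cancel[OF step] show "coeff p (Suc m) * (of_nat (Suc m) * (\<Prod>l\<leftarrow>[]. l + of_nat m))
        = coeff p m * - (a / e) * (\<Prod>u\<leftarrow>[- of_nat n, ?u]. u + of_nat m)"
      by simp
  qed simp_all
  moreover have "coeff p 0 * (a ^ n * pochhammer ?u n) = k * e ^ n"
    using ode_solution_coeff_0[OF sol] b unfolding prod_admissible_factors[OF a] by simp
  then have "coeff p 0 = k * (e / a) ^ n / pochhammer ?u n"
    using a admissible_pochhammer[OF adm a] by (simp add: field_simps)
  ultimately show ?thesis by simp
qed

lemma ode_solution_eq_descending_1F1:
  assumes adm: "admissible a d n" and a: "a \<noteq> 0" and b: "b = 0" and x: "x \<noteq> 0"
  shows "poly p x = k * x ^ n * hyper [- of_nat n] [2 - 2 * of_nat n - d / a] (e / a / x)"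
proof -
  have "poly p x = coeff p n * x ^ n * hyper [- of_nat n] [2 - 2 * of_nat n - d / a] (e / a / x)"
  proof (rule poly_eq_descending_hyper[OF ode_solution_degree(1)[OF sol] x])
    fix j assume "j < n"
    from ode_solution_descent[OF sol \<open>j < n\<close>] b
    have step:
      "coeff p (n - Suc j) * (of_nat (Suc j) * (- a * (2 - 2 * of_nat n - d / a + of_nat j)))
        = coeff p (n - j) * ((of_nat n - of_nat j) * e)"
      unfolding descending_factor[OF a] by simp
    have cancel: "C' * (S * Y) = C * (e / a) * (- N + J)"
      if "C' * (S * (- a * Y)) = C * ((N - J) * e)" for C C' S Y N J
    proof -
      have "(C' * (S * Y)) * a = C * e * (- N + J)"
        using that by (simp add: algebra_simps)
      then have "C' * (S * Y) = C * e * (- N + J) / a"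
        unfolding nonzero_eq_divide_eq[OF a] .
      then show ?thesis by simp
    qed
    from cancel[OF step] show "coeff p (n - Suc j) * (of_nat (Suc j) * (\<Prod>l\<leftarrow>[2 - 2 * of_nat n - d / a]. l + of_nat j))
      = coeff p (n - j) * (e / a) * (\<Prod>u\<leftarrow>[- of_nat n]. u + of_nat j)"
      by simp
  qed (use descending_lower_nonzero[OF adm a] in simp_all)
  then show ?thesis using ode_solution_degree[OF sol] by simp
qed

end

section \<open>Solutions of definite parity\<close>

text \<open>
  The recurrence in degree \<open>m = n - 2 - 2 j\<close>. The product \<open>(m + 1) (m + 2)\<close> equals
  \<open>4 (j - n / 2) (j - n / 2 + 1 / 2)\<close>, which is where the half-integer upper parameters come from.
\<close>
lemma ode_solution_even_descent:
  fixes p :: "'a::field_char_0 poly"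
  assumes sol: "ode_solution a 0 c d 0 k n p" and "j < n div 2"
  shows "coeff p (n - 2 * Suc j) * (of_nat (Suc j) * (2 * (d + (2 * of_nat n - 2 * of_nat j - 3) * a)))
    = coeff p (n - 2 * j) * (4 * c * ((- (of_nat n / 2) + of_nat j) * (- (of_nat n / 2) + 1 / 2 + of_nat j)))"
proof -
  have m: "(of_nat (n - 2 * Suc j) :: 'a) = of_nat n - 2 * of_nat j - 2"
    using \<open>j < n div 2\<close> by (simp add: of_nat_diff)
  have "n - 2 * Suc j + 2 = n - 2 * j" using \<open>j < n div 2\<close> by simp
  moreover have "4 * c * ((- (of_nat n / 2) + of_nat j) * (- (of_nat n / 2) + 1 / 2 + of_nat j))
      = c * ((of_nat n - 2 * of_nat j - 1) * (of_nat n - 2 * of_nat j))"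
    by (simp add: field_simps)
  ultimately show ?thesis
    using ode_solution_recurrence[OF sol, of "n - 2 * Suc j"] unfolding m
    by (simp add: algebra_simps)
qed

text \<open>
  Which of the two half-integer parameters stops the series depends on the parity of \<open>n\<close>.
\<close>
lemma half_integer_upper:
  fixes n :: nat
  shows "- of_nat (n div 2) \<in> set [- (of_nat n / 2), - (of_nat n / 2) + 1 / 2 :: 'a::field_char_0]"
proof (cases "even n")
  case True
  then obtain m where "n = 2 * m" by blast
  then show ?thesis by simp
next
  case False
  then obtain m where "n = 2 * m + 1" by (blast elim: oddE)
  then show ?thesis by (simp add: field_simps)
qed

context
  fixes a c d k :: "'a::{banach, real_normed_field}" and n :: nat and p :: "'a poly"
  assumes sol: "ode_solution a 0 c d 0 k n p" and adm: "admissible a d n"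
begin

text \<open>
  Here the recurrence links degrees \<open>m\<close> and \<open>m + 2\<close> only, and the chain through \<open>n - 1\<close> starts with the
  coefficient of degree \<open>n + 1\<close>, which is zero.
\<close>
lemma ode_solution_parity:
  assumes "m \<le> n" "odd (n - m)"
  shows "coeff p m = 0"
  using assms
proof (induction "n - m" arbitrary: m rule: less_induct)
  case less
  then have "m < n" by (cases "m = n") simp_all
  have "coeff p (m + 2) = 0"
  proof (cases "m + 2 \<le> n")
    case True
    then have "n - (m + 2) < n - m" "odd (n - (m + 2))" using less.prems by auto
    with less.hyps True show ?thesis by blast
  next
    case False
    with ode_solution_degree(1)[OF sol] show ?thesis by (simp add: coeff_eq_0)
  qed
  with ode_solution_recurrence[OF sol, of m]
  have "(of_nat m - of_nat n) * (a * of_nat n + d - a + a * of_nat m) * coeff p m = 0"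
    by simp
  with admissible_recurrence_factor[OF adm \<open>m < n\<close>] show ?case
    using mult_eq_0_iff by blast
qed

text \<open>
  This is the number in \<open>admissible\<close> that belongs to degree \<open>n - 2 - 2 j\<close>. It keeps the lower
  parameter of the series below away from zero.
\<close>
lemma ode_solution_even_factor_nonzero:
  assumes "j < n div 2"
  shows "d + (2 * of_nat n - 2 * of_nat j - 3) * a \<noteq> 0"
proof -
  have "(of_nat (n - 2 * Suc j) :: 'a) = of_nat n - 2 * of_nat j - 2"
    using assms by (simp add: of_nat_diff)
  with admissible_factor[OF adm, of "n - 2 * Suc j"] assms show ?thesis
    by (simp add: algebra_simps)
qed

lemma ode_solution_eq_even_2F1:
  assumes a: "a \<noteq> 0" and x: "x \<noteq> 0"
  shows "poly p x = k * x ^ n * hyper [- (of_nat n / 2), - (of_nat n / 2) + 1 / 2]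
    [3 / 2 - of_nat n - d / (2 * a)] (- (c / a) / x\<^sup>2)"
proof -
  let ?l = "3 / 2 - of_nat n - d / (2 * a)"
  have factor: "2 * (d + (2 * of_nat n - 2 * of_nat j - 3) * a) = - 4 * a * (?l + of_nat j)" for j
    using a by (simp add: field_simps)
  have "poly p x = coeff p n * x ^ n * hyper [- (of_nat n / 2), - (of_nat n / 2) + 1 / 2] [?l] (- (c / a) / x\<^sup>2)"
  proof (rule poly_eq_descending_even_hyper[OF ode_solution_degree(1)[OF sol] x ode_solution_parity _ _ half_integer_upper])
    fix j assume j: "j < n div 2"
    have "- 4 * a * (?l + of_nat j) \<noteq> 0"
      unfolding factor[symmetric] using ode_solution_even_factor_nonzero[OF j]
      by (simp del: distrib_left_numeral)
    then have "?l + of_nat j \<noteq> 0"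
      by (metis mult_zero_right)
    then show "(\<Prod>l\<leftarrow>[?l]. l + of_nat j) \<noteq> 0"
      by simp
    have cancel: "C' * (S * Y) = C * - (c / a) * X" if "C' * (S * (- 4 * a * Y)) = C * (4 * c * X)" for C C' S X Y
    proof -
      have nz: "- 4 * a \<noteq> 0" using a by simp
      have "C' * (S * Y) * (- 4 * a) = C * (4 * c * X)"
        using that by (simp only: ac_simps)
      then have "C' * (S * Y) = C * (4 * c * X) / (- 4 * a)"
        unfolding nonzero_eq_divide_eq[OF nz] .
      then show ?thesis using a by simp
    qed
    from cancel[OF ode_solution_even_descent[OF sol j, unfolded factor]]
    show "coeff p (n - 2 * Suc j) * (of_nat (Suc j) * (\<Prod>l\<leftarrow>[?l]. l + of_nat j))
      = coeff p (n - 2 * j) * - (c / a) * (\<Prod>u\<leftarrow>[- (of_nat n / 2), - (of_nat n / 2) + 1 / 2]. u + of_nat j)"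
      by simp
  qed
  then show ?thesis using ode_solution_degree[OF sol] by simp
qed

end

lemma ode_solution_eq_even_2F0:
  fixes p :: "'a::{banach, real_normed_field} poly"
  assumes sol: "ode_solution 0 0 c d 0 k n p" and d: "d \<noteq> 0" and x: "x \<noteq> 0"
  shows "poly p x = k * x ^ n * hyper [- (of_nat n / 2), - (of_nat n / 2) + 1 / 2] [] (2 * c / d / x\<^sup>2)"
proof -
  have "poly p x = coeff p n * x ^ n * hyper [- (of_nat n / 2), - (of_nat n / 2) + 1 / 2] [] (2 * c / d / x\<^sup>2)"
  proof (rule poly_eq_descending_even_hyper[OF ode_solution_degree(1)[OF sol] x ode_solution_parity[OF sol admissible_0[OF d]] _ _ half_integer_upper])
    fix j assume j: "j < n div 2"
    have cancel: "C' * S = C * (2 * c / d) * X" if "C' * (S * (2 * d)) = C * (4 * c * X)" for C C' S X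
      using that d by (simp add: field_simps)
    from ode_solution_even_descent[OF sol j]
    have step: "coeff p (n - 2 * Suc j) * (of_nat (Suc j) * (2 * d))
      = coeff p (n - 2 * j) * (4 * c * ((- (of_nat n / 2) + of_nat j) * (- (of_nat n / 2) + 1 / 2 + of_nat j)))"
      by simp
    from cancel[OF step]
    show "coeff p (n - 2 * Suc j) * (of_nat (Suc j) * (\<Prod>l\<leftarrow>[]. l + of_nat j))
      = coeff p (n - 2 * j) * (2 * c / d) * (\<Prod>u\<leftarrow>[- (of_nat n / 2), - (of_nat n / 2) + 1 / 2]. u + of_nat j)"
      by simp
  qed simp_all
  then show ?thesis using ode_solution_degree[OF sol] by simp
qed

section \<open>Monic systems\<close>

lemma coeff_eq_if_poly_eq_sum:
  fixes p :: "'a::field_char_0 poly"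
  assumes "\<And>x. poly p x = (\<Sum>m=0..n. C m * x ^ m)" and "\<And>m. m > n \<Longrightarrow> C m = 0"
  shows "coeff p m = C m"
proof -
  have "poly p = poly (\<Sum>m=0..n. monom (C m) m)"
    by (rule ext) (simp add: assms(1) poly_sum poly_monom)
  then have "p = (\<Sum>m=0..n. monom (C m) m)"
    by (simp only: poly_eq_poly_eq_iff)
  then have "coeff p m = (\<Sum>i=0..n. if i = m then C i else 0)"
    by (simp add: coeff_sum)
  with assms(2) show ?thesis by (cases "m \<le> n") simp_all
qed

lemma monic_system_solution:
  assumes "monic_system a b c d e P"
  shows "ode_solution a b c d e 1 n (P n)"
  using assms by (simp add: monic_system_def)

lemma monic_system_d_nonzero:
  fixes a :: "'a::field_char_0"
  assumes "monic_system a b c d e P"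
  shows "d \<noteq> 0"
  using admissible_factor[OF monic_system_admissible[OF assms, of 1], of 0] by simp

lemma monic_system_recurrence:
  fixes a :: "'a::field_char_0"
  assumes "monic_system a b c d e P"
    and "\<forall>n x. poly (P n) x = (\<Sum>m=0..n. C m n * x ^ m)" "\<forall>n m. m > n \<longrightarrow> C m n = 0"
  shows "(of_nat m - of_nat n) * (a * of_nat n + d - a + a * of_nat m) * C m n
    + (of_nat m + 1) * (b * of_nat m + e) * C (m + 1) n
    + c * (of_nat m + 1) * (of_nat m + 2) * C (m + 2) n = 0"
proof -
  have "coeff (P n) m = C m n" for m
    using assms(2,3) by (intro coeff_eq_if_poly_eq_sum) blast+
  with ode_solution_recurrence[OF monic_system_solution[OF assms(1)], of m n] show ?thesis
    by simp
qed

lemma monic_system_two_term_recurrence: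
  fixes a :: "'a::field_char_0"
  assumes "monic_system a b c d e P" "c = 0"
    and "\<forall>n x. poly (P n) x = (\<Sum>m=0..n. C m n * x ^ m)" "\<forall>n m. m > n \<longrightarrow> C m n = 0"
  shows "(of_nat m - of_nat n) * (a * of_nat n + d - a + a * of_nat m) * C m n
    + (of_nat m + 1) * (b * of_nat m + e) * C (m + 1) n = 0"
  using monic_system_recurrence[OF assms(1,3,4), of m n] assms(2) by simp

text \<open>
  Both sides express \<open>(w)\<^sub>2\<^sub>n\<close>: once split after \<open>n\<close> factors, once split into the factors of even and odd
  position.
\<close>
lemma pochhammer_shifted_eq_quotient:
  fixes w :: "'a::field_char_0"
  assumes "pochhammer (w / 2) n \<noteq> 0" "pochhammer ((w + 1) / 2) n \<noteq> 0"
  shows "pochhammer w n / (pochhammer (w / 2) n * pochhammer ((w + 1) / 2) n) = 4 ^ n / pochhammer (w + of_nat n) n"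
proof -
  let ?D = "pochhammer (w / 2) n * pochhammer ((w + 1) / 2) n"
  have "pochhammer w n * pochhammer (w + of_nat n) n = pochhammer w (2 * n)"
    unfolding mult_2 by (rule pochhammer_product'[symmetric])
  also have "\<dots> = 4 ^ n * ?D"
    using pochhammer_double[of "w / 2" n] by (simp add: power_mult add_divide_distrib)
  finally have product: "pochhammer w n * pochhammer (w + of_nat n) n = 4 ^ n * ?D" .
  have D: "?D \<noteq> 0" using assms by simp
  have Y: "pochhammer (w + of_nat n) n \<noteq> 0"
  proof
    assume "pochhammer (w + of_nat n) n = 0"
    with product have "4 ^ n * ?D = 0" by simp
    with D show False by simp
  qed
  show ?thesis by (simp only: frac_eq_eq[OF D Y] product)
qed

text \<open>
  The ascending form with its prefactor rewritten: with \<open>w = (d - a) / a\<close> the upper parameter is \<open>w + n\<close>,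
  and duplication turns \<open>1 / (w + n)\<^sub>n\<close> into a quotient of symbols whose bases do not depend on \<open>n\<close>.
\<close>
lemma monic_system_eq_2F1:
  fixes a :: "'a::{banach, real_normed_field}"
  assumes P: "monic_system a b c d e P" and c: "c = 0"
    and a: "a \<noteq> 0" and b: "b \<noteq> 0" and lower: "pochhammer (e / b) n \<noteq> 0"
    and nz: "pochhammer ((d - a) / (2 * a)) n \<noteq> 0" "pochhammer (d / (2 * a)) n \<noteq> 0"
  shows "poly (P n) x = pochhammer (e / b) n * pochhammer ((d - a) / a) n
    / (pochhammer ((d - a) / (2 * a)) n * pochhammer (d / (2 * a)) n) * (b / (4 * a)) ^ n
    * hyper [- of_nat n, (d + (of_nat n - 1) * a) / a] [e / b] (- (a / b) * x)"
proof -
  define w where "w = (d - a) / a"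
  have w: "(d - a) / (2 * a) = w / 2" "d / (2 * a) = (w + 1) / 2"
      "(d + (of_nat n - 1) * a) / a = w + of_nat n"
    using a by (simp_all add: w_def field_simps)
  have quotient: "pochhammer w n / (pochhammer (w / 2) n * pochhammer ((w + 1) / 2) n)
      = 4 ^ n / pochhammer (w + of_nat n) n"
    using nz unfolding w by (rule pochhammer_shifted_eq_quotient)
  have "1 * (b / a) ^ n * pochhammer (e / b) n / pochhammer (w + of_nat n) n
      = pochhammer (e / b) n * (4 ^ n / pochhammer (w + of_nat n) n) * (b / (4 * a)) ^ n"
    using a by (simp add: power_divide power_mult_distrib ac_simps)
  also have "\<dots> = pochhammer (e / b) n * pochhammer w n
      / (pochhammer (w / 2) n * pochhammer ((w + 1) / 2) n) * (b / (4 * a)) ^ n"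
    unfolding quotient[symmetric] by simp
  finally have factor: "1 * (b / a) ^ n * pochhammer (e / b) n / pochhammer (w + of_nat n) n
      = pochhammer (e / b) n * pochhammer w n
      / (pochhammer (w / 2) n * pochhammer ((w + 1) / 2) n) * (b / (4 * a)) ^ n" .
  show ?thesis
    using ode_solution_eq_ascending_2F1[OF monic_system_solution[OF P[unfolded c], of n] monic_system_admissible[OF P] a b lower, of x]
    unfolding w w_def[symmetric] factor .
qed

lemma monic_system_eq_1F1:
  fixes a :: "'a::{banach, real_normed_field}"
  assumes P: "monic_system a b c d e P" and c: "c = 0" and "a = 0" "b \<noteq> 0" "pochhammer (e / b) n \<noteq> 0"
  shows "poly (P n) x = pochhammer (e / b) n * (b / d) ^ n * hyper [- of_nat n] [e / b] (- (d / b) * x)"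
  using ode_solution_eq_ascending_1F1[OF monic_system_solution[OF P[unfolded c], of n]
      assms(3,4) monic_system_d_nonzero[OF P] assms(5), of x]
  by simp

lemma monic_system_eq_1F0:
  fixes a :: "'a::{banach, real_normed_field}"
  assumes P: "monic_system a b c d e P" and c: "c = 0" and "a = 0" "b = 0" "e \<noteq> 0"
  shows "poly (P n) x = (e / d) ^ n * hyper [- of_nat n] [] (- (d / e) * x)"
  using ode_solution_eq_ascending_1F0[OF monic_system_solution[OF P[unfolded c], of n]
      assms(3,4) monic_system_d_nonzero[OF P] assms(5), of x]
  by simp

section \<open>Classical families\<close>

text \<open>
  The equation is homogeneous, so each representation proved for a general leading coefficient applies to
  the monic version as well.
\<close>
lemma ode_solution_monic_version:
  fixes p :: "'a::field_char_0 poly"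
  assumes "ode_solution a b c d e k n p" "k \<noteq> 0"
  shows "ode_solution a b c d e 1 n (monic_version p)"
proof -
  have k: "monic_version p = smult (inverse k) p"
    using assms by (auto simp: monic_version_def ode_solution_def)
  have "(a * x\<^sup>2 + b * x + c) * (inverse k * poly (pderiv (pderiv p)) x)
      + (d * x + e) * (inverse k * poly (pderiv p) x) + eigenvalue a d n * (inverse k * poly p x)
    = inverse k * ((a * x\<^sup>2 + b * x + c) * poly (pderiv (pderiv p)) x
      + (d * x + e) * poly (pderiv p) x + eigenvalue a d n * poly p x)" for x
    by (simp add: algebra_simps)
  moreover have "(a * x\<^sup>2 + b * x + c) * poly (pderiv (pderiv p)) x
      + (d * x + e) * poly (pderiv p) x + eigenvalue a d n * poly p x = 0" for x
    using assms(1) by (simp add: ode_solution_def)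
  ultimately show ?thesis
    using assms ode_solution_degree[OF assms(1)]
    unfolding k ode_solution_def by (simp add: pderiv_smult)
qed

lemma gchoose_add_eq_pochhammer:
  fixes \<alpha> :: "'a::field_char_0"
  shows "(of_nat n + \<alpha>) gchoose n = pochhammer (\<alpha> + 1) n / fact n"
  by (simp add: gbinomial_pochhammer' algebra_simps)

lemma jacobi_parameters:
  fixes \<alpha> \<beta> :: "'a::field_char_0"
  shows
  "(- (\<alpha> + \<beta> + 2) + (of_nat n - 1) * - 1) / - 1 = of_nat n + \<alpha> + \<beta> + 1"
  "2 - 2 * of_nat n - - (\<alpha> + \<beta> + 2) / - 1 = - 2 * of_nat n - \<alpha> - \<beta>"
  by (simp_all add: algebra_simps)

context
  fixes \<alpha> \<beta> :: "'a::{banach, real_normed_field}" and n :: nat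
  assumes adm: "admissible (-1) (- (\<alpha> + \<beta> + 2)) n"
begin

text \<open>
  For these parameters admissibility says exactly that the prescribed leading coefficient is nonzero.
\<close>
lemma jacobi_leading_coefficient:
  "(2 * of_nat n + \<alpha> + \<beta>) gchoose n = pochhammer (of_nat n + \<alpha> + \<beta> + 1) n / fact n"
  "pochhammer (of_nat n + \<alpha> + \<beta> + 1) n \<noteq> 0"
proof -
  show "(2 * of_nat n + \<alpha> + \<beta>) gchoose n = pochhammer (of_nat n + \<alpha> + \<beta> + 1) n / fact n"
    by (simp add: gbinomial_pochhammer' algebra_simps)
  show "pochhammer (of_nat n + \<alpha> + \<beta> + 1) n \<noteq> 0"
    using admissible_pochhammer[OF adm] by (simp add: algebra_simps)
qed

lemma ode_solution_jacobi:
  "ode_solution (-1) 0 1 (- (\<alpha> + \<beta> + 2)) (\<beta> - \<alpha>) (((2 * of_nat n + \<alpha> + \<beta>) gchoose n) / 2 ^ n) n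
    (jacobi \<alpha> \<beta> n)"
  unfolding jacobi_def
  by (rule ode_solution_ode_poly[OF adm]) (simp add: jacobi_leading_coefficient)

text \<open>
  With \<open>x = t + 1\<close> one has \<open>1 - x\<^sup>2 = -t\<^sup>2 - 2 t\<close>, so \<open>c\<close> has become zero.
\<close>
lemma ode_solution_jacobi_at_1:
  "ode_solution (-1) (-2) 0 (- (\<alpha> + \<beta> + 2)) (-2 * (\<alpha> + 1)) (((2 * of_nat n + \<alpha> + \<beta>) gchoose n) / 2 ^ n) n
    (pcompose (jacobi \<alpha> \<beta> n) [:1, 1:])"
  using ode_solution_shift[OF ode_solution_jacobi, of 1] by (simp add: algebra_simps)

text \<open>
  With \<open>x = t - 1\<close> one has \<open>1 - x\<^sup>2 = -t\<^sup>2 + 2 t\<close>.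
\<close>
lemma ode_solution_jacobi_at_minus_1:
  "ode_solution (-1) 2 0 (- (\<alpha> + \<beta> + 2)) (2 * (\<beta> + 1)) (((2 * of_nat n + \<alpha> + \<beta>) gchoose n) / 2 ^ n) n
    (pcompose (jacobi \<alpha> \<beta> n) [:-1, 1:])"
  using ode_solution_shift[OF ode_solution_jacobi, of "-1"] by (simp add: algebra_simps)

lemma jacobi_ascending_at_1:
  assumes "pochhammer (\<alpha> + 1) n \<noteq> 0"
  shows "poly (jacobi \<alpha> \<beta> n) x = ((of_nat n + \<alpha>) gchoose n)
    * hyper [- of_nat n, of_nat n + \<alpha> + \<beta> + 1] [\<alpha> + 1] ((1 - x) / 2)"
proof -
  have e: "-2 * (\<alpha> + 1) / -2 = \<alpha> + 1" by (rule nonzero_mult_div_cancel_left) simp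
  have z: "- (- 1 / - 2) * (x - 1) = (1 - x) / 2" by (simp add: field_simps)
  show ?thesis
    using ode_solution_eq_ascending_2F1[OF ode_solution_jacobi_at_1 adm, of "x - 1", unfolded e jacobi_parameters z]
      assms jacobi_leading_coefficient(2)
    by (simp add: poly_pcompose jacobi_leading_coefficient(1) gchoose_add_eq_pochhammer)
qed

lemma jacobi_descending_at_1:
  assumes "x \<noteq> 1"
  shows "poly (jacobi \<alpha> \<beta> n) x = ((2 * of_nat n + \<alpha> + \<beta>) gchoose n) * ((x - 1) / 2) ^ n
    * hyper [- of_nat n, - of_nat n - \<alpha>] [- 2 * of_nat n - \<alpha> - \<beta>] (2 / (1 - x))"
proof -
  have e: "1 - of_nat n - -2 * (\<alpha> + 1) / -2 = - of_nat n - \<alpha>"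
    by (subst nonzero_mult_div_cancel_left) simp_all
  have z: "- (- 2 / - 1) / (x - 1) = 2 / (1 - x)" using assms by (simp add: field_simps)
  show ?thesis
    using ode_solution_eq_descending_2F1[OF ode_solution_jacobi_at_1 adm, of "x - 1", unfolded e jacobi_parameters z]
      assms
    by (simp add: poly_pcompose power_divide)
qed

lemma jacobi_ascending_at_minus_1:
  assumes "pochhammer (\<beta> + 1) n \<noteq> 0"
  shows "poly (jacobi \<alpha> \<beta> n) x = (-1) ^ n * ((of_nat n + \<beta>) gchoose n)
    * hyper [- of_nat n, of_nat n + \<alpha> + \<beta> + 1] [\<beta> + 1] ((1 + x) / 2)"
proof -
  have e: "2 * (\<beta> + 1) / 2 = \<beta> + 1" by (rule nonzero_mult_div_cancel_left) simp
  have z: "- (- 1 / 2) * (x + 1) = (1 + x) / 2" by (simp add: field_simps)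
  have sign: "(2 / - 1) ^ n = (- 1) ^ n * (2 ^ n :: 'a)" by (simp add: power_minus[of "2 :: 'a"])
  show ?thesis
    using ode_solution_eq_ascending_2F1[OF ode_solution_jacobi_at_minus_1 adm, of "x + 1", unfolded e jacobi_parameters z sign]
      assms jacobi_leading_coefficient(2)
    by (simp add: poly_pcompose jacobi_leading_coefficient(1) gchoose_add_eq_pochhammer)
qed

lemma jacobi_descending_at_minus_1:
  assumes "x \<noteq> - 1"
  shows "poly (jacobi \<alpha> \<beta> n) x = ((2 * of_nat n + \<alpha> + \<beta>) gchoose n) * ((x + 1) / 2) ^ n
    * hyper [- of_nat n, - of_nat n - \<beta>] [- 2 * of_nat n - \<alpha> - \<beta>] (2 / (1 + x))"
proof -
  have e: "1 - of_nat n - 2 * (\<beta> + 1) / 2 = - of_nat n - \<beta>"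
    by (subst nonzero_mult_div_cancel_left) simp_all
  have z: "- (2 / - 1) / (x + 1) = 2 / (1 + x)" by (simp add: add.commute)
  have "x + 1 \<noteq> 0" using assms by (simp add: add_eq_0_iff2)
  then show ?thesis
    using ode_solution_eq_descending_2F1[OF ode_solution_jacobi_at_minus_1 adm, of "x + 1", unfolded e jacobi_parameters z]
    by (simp add: poly_pcompose power_divide)
qed

end

lemma gegenbauer_type_solution:
  fixes \<alpha> :: "'a::{banach, real_normed_field}"
  assumes sol: "ode_solution (-1) 0 1 (- (2 * \<alpha> + 1)) 0 k n p"
    and adm: "admissible (-1) (- (2 * \<alpha> + 1)) n" and x: "x \<noteq> 0"
  shows "poly p x = k * x ^ n
    * hyper [- (of_nat n / 2), - (of_nat n / 2) + 1 / 2] [- of_nat n - \<alpha> + 1] (1 / x\<^sup>2)"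
proof -
  have l: "3 / 2 - of_nat n - - (2 * \<alpha> + 1) / (2 * - 1) = - of_nat n - \<alpha> + 1"
    by (simp add: field_simps)
  show ?thesis
    using ode_solution_eq_even_2F1[OF sol adm _ x, unfolded l] by simp
qed

lemma ode_solution_gegenbauer:
  fixes \<alpha> :: "'a::{banach, real_normed_field}"
  assumes "admissible (-1) (- (2 * \<alpha> + 1)) n" "pochhammer \<alpha> n \<noteq> 0"
  shows "ode_solution (-1) 0 1 (- (2 * \<alpha> + 1)) 0 (pochhammer \<alpha> n * 2 ^ n / fact n) n (gegenbauer \<alpha> n)"
  unfolding gegenbauer_def using assms by (intro ode_solution_ode_poly) simp_all

text \<open>
  At the zeros of \<open>pochhammer \<alpha> n\<close> the Gegenbauer normalisation prescribes the leading coefficient \<open>0\<close>,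
  which no polynomial of positive degree has, while the monic solution still exists.
\<close>
lemma monic_gegenbauer_ode_poly_form:
  fixes \<alpha> :: "'a::{banach, real_normed_field}"
  assumes "admissible (-1) (- (2 * \<alpha> + 1)) n" "x \<noteq> 0"
  shows "poly (ode_poly (-1) 0 1 (- (2 * \<alpha> + 1)) 0 1 n) x = x ^ n
    * hyper [- (of_nat n / 2), - (of_nat n / 2) + 1 / 2] [- of_nat n - \<alpha> + 1] (1 / x\<^sup>2)"
  using gegenbauer_type_solution[OF ode_solution_ode_poly[OF assms(1)] assms, of 1] by simp

lemma monic_gegenbauer_form:
  fixes \<alpha> :: "'a::{banach, real_normed_field}"
  assumes "admissible (-1) (- (2 * \<alpha> + 1)) n" "x \<noteq> 0" "pochhammer \<alpha> n \<noteq> 0"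
  shows "poly (monic_version (gegenbauer \<alpha> n)) x = x ^ n
    * hyper [- (of_nat n / 2), - (of_nat n / 2) + 1 / 2] [- of_nat n - \<alpha> + 1] (1 / x\<^sup>2)"
  using gegenbauer_type_solution[OF ode_solution_monic_version[OF ode_solution_gegenbauer[OF assms(1,3)]] assms(1,2)]
    assms(3) by simp

lemma gegenbauer_form:
  fixes \<alpha> :: "'a::{banach, real_normed_field}"
  assumes "admissible (-1) (- (2 * \<alpha> + 1)) n" "x \<noteq> 0" "pochhammer \<alpha> n \<noteq> 0"
  shows "poly (gegenbauer \<alpha> n) x = pochhammer \<alpha> n * 2 ^ n * x ^ n / fact n
    * hyper [- (of_nat n / 2), - (of_nat n / 2) + 1 / 2] [- of_nat n - \<alpha> + 1] (1 / x\<^sup>2)"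
  using gegenbauer_type_solution[OF ode_solution_gegenbauer[OF assms(1,3)] assms(1,2)] by simp

lemma ode_solution_laguerre:
  fixes \<alpha> :: "'a::{banach, real_normed_field}"
  shows "ode_solution 0 1 0 (-1) (\<alpha> + 1) ((-1) ^ n / fact n) n (laguerre \<alpha> n)"
  unfolding laguerre_def by (intro ode_solution_ode_poly admissible_0) simp_all

lemma ode_solution_monic_laguerre:
  fixes \<alpha> :: "'a::{banach, real_normed_field}"
  shows "ode_solution 0 1 0 (-1) (\<alpha> + 1) 1 n (monic_version (laguerre \<alpha> n))"
  using ode_solution_monic_version[OF ode_solution_laguerre] by simp

lemma laguerre_type_ascending:
  fixes \<alpha> :: "'a::{banach, real_normed_field}"
  assumes sol: "ode_solution 0 1 0 (-1) (\<alpha> + 1) k n p" and "pochhammer (1 + \<alpha>) n \<noteq> 0"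
  shows "poly p x = k * (pochhammer (1 + \<alpha>) n * (-1) ^ n) * hyper [- of_nat n] [1 + \<alpha>] x"
  using ode_solution_eq_ascending_1F1[OF sol, of x] assms(2) by (simp add: add.commute)

lemma laguerre_type_descending:
  fixes \<alpha> :: "'a::{banach, real_normed_field}"
  assumes sol: "ode_solution 0 1 0 (-1) (\<alpha> + 1) k n p" and "x \<noteq> 0"
  shows "poly p x = k * x ^ n * hyper [- of_nat n, - of_nat n - \<alpha>] [] (- (1 / x))"
  using ode_solution_eq_descending_2F0[OF sol _ _ _ assms(2)] by simp

lemma monic_laguerre_ascending:
  fixes \<alpha> :: "'a::{banach, real_normed_field}"
  assumes "pochhammer (1 + \<alpha>) n \<noteq> 0"
  shows "poly (monic_version (laguerre \<alpha> n)) x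
    = pochhammer (1 + \<alpha>) n * (-1) ^ n * hyper [- of_nat n] [1 + \<alpha>] x"
  using laguerre_type_ascending[OF ode_solution_monic_laguerre assms, of x] by simp

lemma laguerre_ascending:
  fixes \<alpha> :: "'a::{banach, real_normed_field}"
  assumes "pochhammer (1 + \<alpha>) n \<noteq> 0"
  shows "poly (laguerre \<alpha> n) x = ((of_nat n + \<alpha>) gchoose n) * hyper [- of_nat n] [1 + \<alpha>] x"
proof -
  have "(-1) ^ n * (-1) ^ n = (1 :: 'a)" by (simp flip: power_mult_distrib)
  then have "(-1) ^ n / fact n * (pochhammer (1 + \<alpha>) n * (-1) ^ n) = (of_nat n + \<alpha>) gchoose n"
    by (simp add: gchoose_add_eq_pochhammer add.commute[of 1])
  with laguerre_type_ascending[OF ode_solution_laguerre assms, of x] show ?thesis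
    by (simp only:)
qed

lemma monic_laguerre_descending:
  fixes \<alpha> :: "'a::{banach, real_normed_field}"
  assumes "x \<noteq> 0"
  shows "poly (monic_version (laguerre \<alpha> n)) x
    = x ^ n * hyper [- of_nat n, - of_nat n - \<alpha>] [] (- (1 / x))"
  using laguerre_type_descending[OF ode_solution_monic_laguerre assms] by simp

lemma laguerre_descending:
  fixes \<alpha> :: "'a::{banach, real_normed_field}"
  assumes "x \<noteq> 0"
  shows "poly (laguerre \<alpha> n) x
    = (- x) ^ n / fact n * hyper [- of_nat n, - of_nat n - \<alpha>] [] (- (1 / x))"
  using laguerre_type_descending[OF ode_solution_laguerre assms] by (simp add: power_minus[of x])

lemma ode_solution_hermite:
  "ode_solution 0 0 1 (-2) 0 (2 ^ n) n (hermite n :: 'a::{banach, real_normed_field} poly)"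
  unfolding hermite_def by (intro ode_solution_ode_poly admissible_0) simp_all

lemma hermite_type_solution:
  fixes p :: "'a::{banach, real_normed_field} poly"
  assumes sol: "ode_solution 0 0 1 (-2) 0 k n p" and "x \<noteq> 0"
  shows "poly p x = k * x ^ n * hyper [- (of_nat n / 2), - (of_nat n / 2) + 1 / 2] [] (- (1 / x\<^sup>2))"
  using ode_solution_eq_even_2F0[OF sol _ assms(2)] by simp

lemma monic_hermite_form:
  fixes x :: "'a::{banach, real_normed_field}"
  assumes "x \<noteq> 0"
  shows "poly (monic_version (hermite n)) x
    = x ^ n * hyper [- (of_nat n / 2), - (of_nat n / 2) + 1 / 2] [] (- (1 / x\<^sup>2))"
  using hermite_type_solution[OF ode_solution_monic_version[OF ode_solution_hermite] assms] by simp

lemma hermite_form: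
  fixes x :: "'a::{banach, real_normed_field}"
  assumes "x \<noteq> 0"
  shows "poly (hermite n) x
    = 2 ^ n * x ^ n * hyper [- (of_nat n / 2), - (of_nat n / 2) + 1 / 2] [] (- (1 / x\<^sup>2))"
  using hermite_type_solution[OF ode_solution_hermite assms] .

context
  fixes \<alpha> :: "'a::{banach, real_normed_field}" and n :: nat
  assumes adm: "admissible 1 (\<alpha> + 2) n"
begin

text \<open>
  As for Jacobi polynomials, admissibility means that the leading coefficient does not vanish.
\<close>
lemma bessel_leading_coefficient_nonzero: "pochhammer (of_nat n + \<alpha> + 1) n \<noteq> 0"
  using admissible_pochhammer[OF adm] by (simp add: algebra_simps)

lemma ode_solution_bessel:
  "ode_solution 1 0 0 (\<alpha> + 2) 2 (pochhammer (of_nat n + \<alpha> + 1) n / 2 ^ n) n (bessel \<alpha> n)"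
  unfolding bessel_def
  by (rule ode_solution_ode_poly[OF adm]) (simp add: bessel_leading_coefficient_nonzero)

lemma ode_solution_monic_bessel: "ode_solution 1 0 0 (\<alpha> + 2) 2 1 n (monic_version (bessel \<alpha> n))"
  using ode_solution_monic_version[OF ode_solution_bessel] bessel_leading_coefficient_nonzero by simp

lemma bessel_type_ascending:
  assumes sol: "ode_solution 1 0 0 (\<alpha> + 2) 2 k n p"
  shows "poly p x = k * 2 ^ n / pochhammer (of_nat n + \<alpha> + 1) n
    * hyper [- of_nat n, of_nat n + \<alpha> + 1] [] (- (x / 2))"
proof -
  have u: "(\<alpha> + 2 + (of_nat n - 1) * 1) / 1 = of_nat n + \<alpha> + 1" by simp
  show ?thesis
    using ode_solution_eq_ascending_2F0[OF sol adm, of x, unfolded u] by simp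
qed

lemma bessel_type_descending:
  assumes sol: "ode_solution 1 0 0 (\<alpha> + 2) 2 k n p" and "x \<noteq> 0"
  shows "poly p x = k * x ^ n * hyper [- of_nat n] [- 2 * of_nat n - \<alpha>] (2 / x)"
proof -
  have l: "2 - 2 * of_nat n - (\<alpha> + 2) / 1 = - 2 * of_nat n - \<alpha>" by simp
  show ?thesis
    using ode_solution_eq_descending_1F1[OF sol adm, of x, unfolded l] assms by simp
qed

lemma monic_bessel_ascending:
  "poly (monic_version (bessel \<alpha> n)) x = 2 ^ n / pochhammer (of_nat n + \<alpha> + 1) n
    * hyper [- of_nat n, of_nat n + \<alpha> + 1] [] (- (x / 2))"
  using bessel_type_ascending[OF ode_solution_monic_bessel, of x] by simp

lemma bessel_ascending:
  "poly (bessel \<alpha> n) x = hyper [- of_nat n, of_nat n + \<alpha> + 1] [] (- (x / 2))"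
  using bessel_type_ascending[OF ode_solution_bessel, of x] bessel_leading_coefficient_nonzero by simp

lemma monic_bessel_descending:
  assumes "x \<noteq> 0"
  shows "poly (monic_version (bessel \<alpha> n)) x
    = x ^ n * hyper [- of_nat n] [- 2 * of_nat n - \<alpha>] (2 / x)"
  using bessel_type_descending[OF ode_solution_monic_bessel assms] by simp

lemma bessel_descending:
  assumes "x \<noteq> 0"
  shows "poly (bessel \<alpha> n) x = pochhammer (of_nat n + \<alpha> + 1) n / 2 ^ n * x ^ n
    * hyper [- of_nat n] [- 2 * of_nat n - \<alpha>] (2 / x)"
  using bessel_type_descending[OF ode_solution_bessel assms] .

end


theorem theorem4:
  shows
    "(\<forall>(a::'a::{banach, real_normed_field}) b c d e P C.
        monic_system a b c d e P \<and>
        (\<forall>n x. poly (P n) x = (\<Sum>m=0..n. C m n * x ^ m)) \<and>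
        (\<forall>n m. m > n \<longrightarrow> C m n = 0) \<longrightarrow>
        (\<forall>n m. (of_nat m - of_nat n) * (a * of_nat n + d - a + a * of_nat m) * C m n
               + (of_nat m + 1) * (b * of_nat m + e) * C (m + 1) n
               + c * (of_nat m + 1) * (of_nat m + 2) * C (m + 2) n = 0) \<and>
        (c = 0 \<longrightarrow>
          (\<forall>n m. (of_nat m - of_nat n) * (a * of_nat n + d - a + a * of_nat m) * C m n
                 + (of_nat m + 1) * (b * of_nat m + e) * C (m + 1) n = 0) \<and>
          (\<forall>n x. a \<noteq> 0 \<and> b \<noteq> 0 \<and> pochhammer (e / b) n \<noteq> 0 \<and>
                 pochhammer ((d - a) / (2 * a)) n \<noteq> 0 \<and> pochhammer (d / (2 * a)) n \<noteq> 0 \<longrightarrow>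
                 poly (P n) x =
                   pochhammer (e / b) n * pochhammer ((d - a) / a) n
                   / (pochhammer ((d - a) / (2 * a)) n * pochhammer (d / (2 * a)) n)
                   * (b / (4 * a)) ^ n
                   * hyper [- of_nat n, (d + (of_nat n - 1) * a) / a] [e / b] (- (a / b) * x)) \<and>
          (\<forall>n x. a = 0 \<and> b \<noteq> 0 \<and> pochhammer (e / b) n \<noteq> 0 \<longrightarrow>
                 poly (P n) x =
                   pochhammer (e / b) n * (b / d) ^ n
                   * hyper [- of_nat n] [e / b] (- (d / b) * x)) \<and>
          (\<forall>n x. a = 0 \<and> b = 0 \<and> e \<noteq> 0 \<longrightarrow>
                 poly (P n) x = (e / d) ^ n * hyper [- of_nat n] [] (- (d / e) * x))))
     \<and>
     (\<forall>(\<alpha>::'a) \<beta> n x. admissible (-1) (- (\<alpha> + \<beta> + 2)) n \<longrightarrow>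
        (pochhammer (\<alpha> + 1) n \<noteq> 0 \<longrightarrow>
           poly (jacobi \<alpha> \<beta> n) x =
             ((of_nat n + \<alpha>) gchoose n)
             * hyper [- of_nat n, of_nat n + \<alpha> + \<beta> + 1] [\<alpha> + 1] ((1 - x) / 2)) \<and>
        (x \<noteq> 1 \<longrightarrow>
           poly (jacobi \<alpha> \<beta> n) x =
             ((2 * of_nat n + \<alpha> + \<beta>) gchoose n) * ((x - 1) / 2) ^ n
             * hyper [- of_nat n, - of_nat n - \<alpha>] [- 2 * of_nat n - \<alpha> - \<beta>] (2 / (1 - x))) \<and>
        (pochhammer (\<beta> + 1) n \<noteq> 0 \<longrightarrow>
           poly (jacobi \<alpha> \<beta> n) x =
             (-1) ^ n * ((of_nat n + \<beta>) gchoose n)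
             * hyper [- of_nat n, of_nat n + \<alpha> + \<beta> + 1] [\<beta> + 1] ((1 + x) / 2)) \<and>
        (x \<noteq> -1 \<longrightarrow>
           poly (jacobi \<alpha> \<beta> n) x =
             ((2 * of_nat n + \<alpha> + \<beta>) gchoose n) * ((x + 1) / 2) ^ n
             * hyper [- of_nat n, - of_nat n - \<beta>] [- 2 * of_nat n - \<alpha> - \<beta>] (2 / (1 + x))))
     \<and>
     (\<forall>(\<alpha>::'a) n x. admissible (-1) (- (2 * \<alpha> + 1)) n \<and> x \<noteq> 0 \<longrightarrow>
        poly (ode_poly (-1) 0 1 (- (2 * \<alpha> + 1)) 0 1 n) x =
          x ^ n * hyper [- (of_nat n / 2), - (of_nat n / 2) + 1 / 2] [- of_nat n - \<alpha> + 1] (1 / x\<^sup>2) \<and>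
        (pochhammer \<alpha> n \<noteq> 0 \<longrightarrow>
           poly (monic_version (gegenbauer \<alpha> n)) x =
             x ^ n * hyper [- (of_nat n / 2), - (of_nat n / 2) + 1 / 2] [- of_nat n - \<alpha> + 1] (1 / x\<^sup>2) \<and>
           poly (gegenbauer \<alpha> n) x =
             pochhammer \<alpha> n * 2 ^ n * x ^ n / fact n
             * hyper [- (of_nat n / 2), - (of_nat n / 2) + 1 / 2] [- of_nat n - \<alpha> + 1] (1 / x\<^sup>2)))
     \<and>
     (\<forall>(\<alpha>::'a) n x.
        (pochhammer (1 + \<alpha>) n \<noteq> 0 \<longrightarrow>
           poly (monic_version (laguerre \<alpha> n)) x =
             pochhammer (1 + \<alpha>) n * (-1) ^ n * hyper [- of_nat n] [1 + \<alpha>] x \<and>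
           poly (laguerre \<alpha> n) x =
             ((of_nat n + \<alpha>) gchoose n) * hyper [- of_nat n] [1 + \<alpha>] x) \<and>
        (x \<noteq> 0 \<longrightarrow>
           poly (monic_version (laguerre \<alpha> n)) x =
             x ^ n * hyper [- of_nat n, - of_nat n - \<alpha>] [] (- (1 / x)) \<and>
           poly (laguerre \<alpha> n) x =
             (- x) ^ n / fact n * hyper [- of_nat n, - of_nat n - \<alpha>] [] (- (1 / x))))
     \<and>
     (\<forall>n (x::'a). x \<noteq> 0 \<longrightarrow>
        poly (monic_version (hermite n)) x =
          x ^ n * hyper [- (of_nat n / 2), - (of_nat n / 2) + 1 / 2] [] (- (1 / x\<^sup>2)) \<and>
        poly (hermite n) x =
          2 ^ n * x ^ n * hyper [- (of_nat n / 2), - (of_nat n / 2) + 1 / 2] [] (- (1 / x\<^sup>2)))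
     \<and>
     (\<forall>(\<alpha>::'a) n x. admissible 1 (\<alpha> + 2) n \<longrightarrow>
        poly (monic_version (bessel \<alpha> n)) x =
          2 ^ n / pochhammer (of_nat n + \<alpha> + 1) n
          * hyper [- of_nat n, of_nat n + \<alpha> + 1] [] (- (x / 2)) \<and>
        poly (bessel \<alpha> n) x =
          hyper [- of_nat n, of_nat n + \<alpha> + 1] [] (- (x / 2)) \<and>
        (x \<noteq> 0 \<longrightarrow>
           poly (monic_version (bessel \<alpha> n)) x =
             x ^ n * hyper [- of_nat n] [- 2 * of_nat n - \<alpha>] (2 / x) \<and>
           poly (bessel \<alpha> n) x =
             pochhammer (of_nat n + \<alpha> + 1) n / 2 ^ n * x ^ n
             * hyper [- of_nat n] [- 2 * of_nat n - \<alpha>] (2 / x)))"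
proof (intro conjI allI impI; (elim conjE)?)
qed (rule
    monic_system_recurrence monic_system_two_term_recurrence
    monic_system_eq_2F1 monic_system_eq_1F1 monic_system_eq_1F0
    jacobi_ascending_at_1 jacobi_descending_at_1
    jacobi_ascending_at_minus_1 jacobi_descending_at_minus_1
    monic_gegenbauer_ode_poly_form monic_gegenbauer_form gegenbauer_form
    monic_laguerre_ascending laguerre_ascending monic_laguerre_descending laguerre_descending
    monic_hermite_form hermite_form
    monic_bessel_ascending bessel_ascending monic_bessel_descending bessel_descending;
    assumption)+

end
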